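(* Let $a,d\in\mathbb{R}$ with $ad>-1$, $|a-d|>2$ and $a+d\neq0$, and let $A_4=\begin{pmatrix} a & -1\\ 1 & d\end{pmatrix}$. Then $\mathrm{Spec}(A_4D)$ is infinite, and there is a constant $y_0>0$, depending only upon $(a,d)$, such that $$\mathrm{Spec}(A_4D)\subset\{(r+iy_0)^2:r\in\mathbb{R}\}+[0,\infty)\qquad\text{if } a+d>0,$$ $$\mathrm{Spec}(A_4D)\subset\{-(r+iy_0)^2:r\in\mathbb{R}\}+(-\infty,0]\qquad\text{if } a+d<0.$$
   Context: Let $W^{2,2}$ be the Sobolev space of all $f\in L^2(0,1)\otimes\mathbb{C}^2$ whose generalized derivative $f''$ lies in $L^2(0,1)\otimes\mathbb{C}^2$, and write $f=\begin{pmatrix}\phi\\ \gamma\end{pmatrix}$. The operator $D$ acts on $L^2(0,1)\otimes\mathbb{C}^2$ by $Df=-f''$ with domain $\mathrm{Dom}(D)=\{f\in W^{2,2}:\phi(0)=\phi(1)=0,\ \gamma'(0)=\gamma'(1)=0\}$. For a constant $2\times2$ matrix $A$, $AD$ is the operator $f\mapsto -Af''$ with domain $\mathrm{Dom}(D)$. $\mathrm{Spec}$ denotes the spectrum. The sum of two subsets of $\mathbb{C}$ is $X+Y=\{x+y:x\in X,\ y\in Y\}$. *)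

theory Defs
  imports "HOL-Analysis.Analysis"
begin

abbreviation unit_interval :: "real measure" where
  "unit_interval \<equiv> lebesgue_on {0<..<1}"

text \<open>
  Elements of \<open>L\<^sup>2(0,1) \<otimes> \<complex>\<^sup>2\<close> are represented by functions, two of which denote the same
  element iff they agree almost everywhere. Every notion below respects this identification.
\<close>

definition L2_space :: "(real \<Rightarrow> complex^2) set" where
  "L2_space = {f. f \<in> borel_measurable unit_interval
                  \<and> integrable unit_interval (\<lambda>x. (norm (f x))\<^sup>2)}"

definition L2_norm :: "(real \<Rightarrow> complex^2) \<Rightarrow> real" where
  "L2_norm f = sqrt (\<integral>x. (norm (f x))\<^sup>2 \<partial>unit_interval)"

definition ae_eq :: "(real \<Rightarrow> complex^2) \<Rightarrow> (real \<Rightarrow> complex^2) \<Rightarrow> bool" (infix \<open>=\<^sub>a\<^sub>e\<close> 50) where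
  "f =\<^sub>a\<^sub>e g \<longleftrightarrow> (AE x in unit_interval. f x = g x)"

definition test_function :: "(real \<Rightarrow> real) \<Rightarrow> bool" where
  "test_function \<psi> \<longleftrightarrow>
     (\<forall>n x. (deriv ^^ n) \<psi> field_differentiable at x) \<and>
     (\<exists>K. compact K \<and> K \<subseteq> {0<..<1} \<and> (\<forall>x. x \<notin> K \<longrightarrow> \<psi> x = 0))"

definition has_weak_deriv :: "nat \<Rightarrow> (real \<Rightarrow> complex^2) \<Rightarrow> (real \<Rightarrow> complex^2) \<Rightarrow> bool" where
  "has_weak_deriv n f g \<longleftrightarrow>
     (\<forall>\<psi>. test_function \<psi> \<longrightarrow>
        (\<integral>x. (deriv ^^ n) \<psi> x *\<^sub>R f x \<partial>unit_interval)
          = (-1) ^ n *\<^sub>R (\<integral>x. \<psi> x *\<^sub>R g x \<partial>unit_interval))"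

definition W22 :: "(real \<Rightarrow> complex^2) set" where
  "W22 = {f \<in> L2_space. \<exists>g \<in> L2_space. has_weak_deriv 2 f g}"

text \<open>
  Boundary values of \<open>f \<in> W\<^sup>2\<^sup>,\<^sup>2\<close> and of its derivative are those of the unique representative \<open>F\<close>
  of \<open>f\<close> that is continuously differentiable on the closed interval, with derivative \<open>F'\<close>.
\<close>

definition C1_representative ::
  "(real \<Rightarrow> complex^2) \<Rightarrow> (real \<Rightarrow> complex^2) \<Rightarrow> (real \<Rightarrow> complex^2) \<Rightarrow> bool" where
  "C1_representative f F F' \<longleftrightarrow>
     f =\<^sub>a\<^sub>e F \<and>
     (\<forall>x\<in>{0..1}. (F has_vector_derivative F' x) (at x within {0..1})) \<and>
     continuous_on {0..1} F'"

definition Dom_D :: "(real \<Rightarrow> complex^2) set" where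
  "Dom_D = {f \<in> W22. \<exists>F F'. C1_representative f F F' \<and>
              F 0 $ 1 = 0 \<and> F 1 $ 1 = 0 \<and> F' 0 $ 2 = 0 \<and> F' 1 $ 2 = 0}"

text \<open>
  Unbounded operators are given by their graphs, which contain all representatives
  of both the argument and the value.
\<close>

type_synonym operator = "((real \<Rightarrow> complex^2) \<times> (real \<Rightarrow> complex^2)) set"

definition D_op :: operator where
  "D_op = {(f, h). f \<in> Dom_D \<and> h \<in> L2_space \<and>
             (\<exists>g \<in> L2_space. has_weak_deriv 2 f g \<and> h =\<^sub>a\<^sub>e (\<lambda>x. - g x))}"

definition matrix_times_op :: "complex^2^2 \<Rightarrow> operator \<Rightarrow> operator" where
  "matrix_times_op A T = {(f, u). u \<in> L2_space \<and> (\<exists>h. (f, h) \<in> T \<and> u =\<^sub>a\<^sub>e (\<lambda>x. A *v h x))}"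

text \<open>
  \<open>z\<close> is in the resolvent set iff \<open>T - z\<close> maps its domain bijectively onto the whole space
  and the inverse is bounded.
\<close>

definition resolvent_set :: "operator \<Rightarrow> complex set" where
  "resolvent_set T = {z.
     (\<forall>h \<in> L2_space. \<exists>(f, u) \<in> T. (\<lambda>x. u x - z *s f x) =\<^sub>a\<^sub>e h) \<and>
     (\<forall>(f, u) \<in> T. \<forall>(f', u') \<in> T.
        (\<lambda>x. u x - z *s f x) =\<^sub>a\<^sub>e (\<lambda>x. u' x - z *s f' x) \<longrightarrow> f =\<^sub>a\<^sub>e f') \<and>
     (\<exists>C. \<forall>(f, u) \<in> T. L2_norm f \<le> C * L2_norm (\<lambda>x. u x - z *s f x))}"

definition Spec :: "operator \<Rightarrow> complex set" where
  "Spec T = - resolvent_set T"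

definition A4 :: "real \<Rightarrow> real \<Rightarrow> complex^2^2" where
  "A4 a d = vector [vector [complex_of_real a, -1],
                    vector [1, complex_of_real d]]"

end

theory Submission
  imports Defs "HOL-Computational_Algebra.Polynomial"
begin

text \<open>
  The matrix has two distinct real eigenvalues \<open>a - c\<^sub>1\<close> and \<open>a - c\<^sub>2\<close>, both of the sign of
  \<open>a + d\<close>, with \<open>c\<^sub>1 c\<^sub>2 = 1\<close>. The coordinates \<open>y\<^sub>j = \<phi> - c\<^sub>j \<gamma>\<close> decouple the eigenvalue equation
  for \<open>z = \<plusminus>w\<^sup>2\<close> into \<open>y\<^sub>j'' = - (m\<^sub>j w)\<^sup>2 y\<^sub>j\<close> with \<open>m\<^sub>j > 0\<close>, which the boundary conditions
  couple again; \<open>z \<noteq> 0\<close> is in the spectrum iff the resulting \<open>2 \<times> 2\<close> determinant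
  \<open>2 - (1 + \<mu>) cos ((m\<^sub>1 - m\<^sub>2) w) + (\<mu> - 1) cos ((m\<^sub>1 + m\<^sub>2) w)\<close> vanishes, where \<open>\<mu> \<ge> 1\<close> by AM-GM.
  On the real axis it is \<open>\<le> 0\<close> at the maxima and \<open>> 0\<close> at the minima of
  \<open>cos ((m\<^sub>1 - m\<^sub>2) w)\<close>, which gives infinitely many zeros. For large \<open>\<bar>Im w\<bar>\<close> the cosine of
  the larger frequency dominates (for \<open>\<mu> = 1\<close> it is absent, and all zeros are real), so the zeros
  lie in a strip \<open>\<bar>Im w\<bar> \<le> y\<^sub>0\<close>, whose image under squaring is the region bounded by the parabola.

  With weak derivatives and representatives eliminated, a pair \<open>(f, u)\<close> in the graph is a \<open>C\<^sup>1\<close>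
  function with \<open>A f'(x) = A f'(0) - \<integral>\<^sub>0\<^sup>x u\<close>; this needs the lemma of du Bois-Reymond.
\<close>

section \<open>Functions on the unit interval\<close>

text \<open>The right-hand side \<open>h\<close> of the resolvent equation is only square
  integrable, so \<open>f'\<close> need not be differentiable everywhere; all equations are
  therefore integrated once, and only continuous primitives are handled. The boundary conditions at
  0 allow exactly the starting values y_j(0) = c_j \<alpha>, y_j'(0) = \<beta>, and those at 1 then
  become two linear equations for \<alpha> and \<beta>. If their determinant is nonzero, Cramer's
  rule bounds \<alpha>, \<beta> and hence the solution by a multiple of the norm of \<open>h\<close>
  that does not depend on \<open>h\<close>, which is the bounded inverse; if it vanishes, a kernel
  vector yields an eigenfunction. The eigenvalues of the matrix have product ad + 1 and sum a + d,
  whence their common sign, and m_j is the inverse root of the modulus of a - c_j. The number \<mu>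
  is the mean of c_2^2 m_2/m_1 and c_1^2 m_1/m_2, two positive numbers with product (c_1 c_2)^2 = 1.
  Whether 0 lies in the spectrum is never decided: w = 0 lies in the strip anyway.\<close>

lemma finite_measure_unit_interval: "finite_measure unit_interval"
  by (rule finite_measure_lebesgue_on) simp

lemma measure_unit_interval: "measure unit_interval (space unit_interval) = 1"
  by (simp add: measure_restrict_space)

text \<open>The endpoints are moved into the exceptional set, so that gauge integrals over closed
  subintervals can ignore it.\<close>

lemma AE_unit_intervalE:
  assumes "AE x in unit_interval. P x"
  obtains N where "negligible N" "\<And>x. x \<in> {0..1} - N \<Longrightarrow> P x"
proof -
  have "AE x in lebesgue. x \<in> {0<..<1} \<longrightarrow> P x"
    using assms by (subst (asm) AE_restrict_space_iff) auto
  then obtain N where N: "{x. \<not> (x \<in> {0<..<1} \<longrightarrow> P x)} \<subseteq> N" "N \<in> null_sets lebesgue"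
    by (auto simp: eventually_ae_filter)
  show thesis
  proof (rule that[of "N \<union> {0,1}"])
    show "negligible (N \<union> {0,1})"
      using N(2) unfolding negligible_iff_null_sets[symmetric]
      by (rule negligible_Un) (rule negligible_finite, simp)
    show "P x" if "x \<in> {0..1} - (N \<union> {0,1})" for x
    proof -
      have "x \<in> {0<..<1}" "x \<notin> N" using that by (auto simp: less_le)
      then show ?thesis using N(1) by blast
    qed
  qed
qed

lemma integral_cong_AE_unit_interval:
  assumes "AE x in unit_interval. f x = g x" "0 \<le> a" "b \<le> 1"
  shows "integral {a..b} f = integral {a..b} g"
proof -
  obtain N where "negligible N" "\<And>x. x \<in> {0..1} - N \<Longrightarrow> f x = g x"
    using AE_unit_intervalE[OF assms(1)] by metis
  then show ?thesis
    using assms by (intro integral_spike[of N]) auto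
qed

text \<open>By continuity a difference at \<open>x\<close> persists on an interval around
  \<open>x\<close>. Clipped to the unit interval this still has positive length, even when
  \<open>x\<close> is an endpoint, so it is not negligible.\<close>

lemma continuous_eq_if_AE_eq:
  fixes f g :: "real \<Rightarrow> 'a::real_normed_vector"
  assumes "AE x in unit_interval. f x = g x"
    and f: "continuous_on {0..1} f" and g: "continuous_on {0..1} g" and x: "x \<in> {0..1}"
  shows "f x = g x"
proof (rule ccontr)
  assume ne: "f x \<noteq> g x"
  obtain N where N: "negligible N" "\<And>x. x \<in> {0..1} - N \<Longrightarrow> f x = g x"
    using AE_unit_intervalE[OF assms(1)] by metis
  have "continuous_on {0..1} (\<lambda>y. norm (f y - g y))"
    by (intro continuous_intros f g)
  then obtain e where e: "e > 0" "\<And>y. y \<in> {0..1} \<Longrightarrow> dist y x < e \<Longrightarrow>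
      dist (norm (f y - g y)) (norm (f x - g x)) < norm (f x - g x)"
    using x ne unfolding continuous_on_iff by (metis right_minus_eq zero_less_norm_iff)
  have ne': "f y \<noteq> g y" if "y \<in> {0..1}" "dist y x < e" for y
    using e(2)[OF that] by (auto simp: dist_norm)
  have "{max 0 (x - e/2) .. min 1 (x + e/2)} \<subseteq> N"
  proof
    fix y assume "y \<in> {max 0 (x - e/2) .. min 1 (x + e/2)}"
    then have "y \<in> {0..1}" "dist y x < e" using e(1) by (auto simp: dist_real_def)
    then show "y \<in> N" using N(2)[of y] ne' by blast
  qed
  then have "negligible {max 0 (x - e/2) .. min 1 (x + e/2)}"
    using N negligible_subset by blast
  moreover have "max 0 (x - e/2) < min 1 (x + e/2)"
    using x e by auto
  ultimately show False
    using negligible_interval(1)[of "max 0 (x - e/2)" "min 1 (x + e/2)"]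
    unfolding box_real greaterThanLessThan_empty_iff by linarith
qed

section \<open>Square-integrable functions and the two integrals\<close>

lemma L2_spaceD:
  assumes "f \<in> L2_space"
  shows "f \<in> borel_measurable unit_interval" "integrable unit_interval (\<lambda>x. (norm (f x))\<^sup>2)"
  using assms by (auto simp: L2_space_def)

lemma L2_norm_nonneg [simp]: "0 \<le> L2_norm f"
  by (simp add: L2_norm_def)

lemma integrable_L2:
  assumes "f \<in> L2_space"
  shows "integrable unit_interval f"
proof -
  interpret finite_measure unit_interval by (rule finite_measure_unit_interval)
  show ?thesis
  proof (rule Bochner_Integration.integrable_bound)
    show "integrable unit_interval (\<lambda>x. 1 + (norm (f x))\<^sup>2)"
      using L2_spaceD[OF assms] by (intro Bochner_Integration.integrable_add integrable_const)
    show "AE x in unit_interval. norm (f x) \<le> norm (1 + (norm (f x))\<^sup>2)"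
    proof (rule AE_I2)
      fix x
      have "2 * norm (f x) \<le> 1 + (norm (f x))\<^sup>2"
        using zero_le_power2[of "norm (f x) - 1"] unfolding power2_diff by simp
      then have "norm (f x) \<le> 1 + (norm (f x))\<^sup>2" using norm_ge_zero[of "f x"] by linarith
      then show "norm (f x) \<le> norm (1 + (norm (f x))\<^sup>2)" by simp
    qed
  qed (use L2_spaceD[OF assms] in auto)
qed

text \<open>The interval has measure 1, so this is the nonnegativity of the variance of
  \<open>norm (f x)\<close>.\<close>

lemma integral_norm_le_L2_norm:
  assumes "f \<in> L2_space"
  shows "(\<integral>x. norm (f x) \<partial>unit_interval) \<le> L2_norm f"
proof -
  interpret finite_measure unit_interval by (rule finite_measure_unit_interval)
  let ?m = "\<integral>x. norm (f x) \<partial>unit_interval"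
  have i1: "integrable unit_interval (\<lambda>x. norm (f x))" using integrable_L2[OF assms] by simp
  have "0 \<le> (\<integral>x. (norm (f x) - ?m)\<^sup>2 \<partial>unit_interval)" by simp
  also have "\<dots> = (\<integral>x. (norm (f x))\<^sup>2 - 2 * ?m * norm (f x) + ?m\<^sup>2 \<partial>unit_interval)"
    by (intro Bochner_Integration.integral_cong) (auto simp: power2_eq_square algebra_simps)
  also have "\<dots> = (\<integral>x. (norm (f x))\<^sup>2 \<partial>unit_interval) - 2 * ?m * ?m + ?m\<^sup>2"
    using i1 L2_spaceD[OF assms] measure_unit_interval
    by (simp add: Bochner_Integration.integral_add Bochner_Integration.integral_diff)
  finally have "?m\<^sup>2 \<le> (\<integral>x. (norm (f x))\<^sup>2 \<partial>unit_interval)"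
    by (simp add: power2_eq_square)
  then show ?thesis unfolding L2_norm_def by (rule real_le_rsqrt)
qed

lemma L2_norm_cong:
  assumes "f =\<^sub>a\<^sub>e g" "f \<in> borel_measurable unit_interval" "g \<in> borel_measurable unit_interval"
  shows "L2_norm f = L2_norm g"
  unfolding L2_norm_def using assms
  by (intro arg_cong[of _ _ sqrt] integral_cong_AE) (auto simp: ae_eq_def)

text \<open>Lebesgue measure is complete; extension by zero transfers this from the line to the
  interval.\<close>

lemma borel_measurable_ae_eq:
  assumes "f =\<^sub>a\<^sub>e g" "g \<in> borel_measurable unit_interval"
  shows "f \<in> borel_measurable unit_interval"
proof -
  let ?e = "\<lambda>f x. if x \<in> {0<..<1} then f x else 0"
  have "?e g \<in> borel_measurable lebesgue"
    using assms(2) by (subst borel_measurable_if) auto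
  moreover have "AE x in lebesgue. ?e g x = ?e f x"
    using assms(1) unfolding ae_eq_def by (subst (asm) AE_restrict_space_iff) auto
  ultimately have "?e f \<in> borel_measurable lebesgue"
    by (rule borel_measurable_AE)
  then show ?thesis by (subst (asm) borel_measurable_if) auto
qed

lemma L2_space_cong:
  assumes "f =\<^sub>a\<^sub>e g" "g \<in> L2_space"
  shows "f \<in> L2_space"
proof -
  have m: "f \<in> borel_measurable unit_interval" "g \<in> borel_measurable unit_interval"
    using borel_measurable_ae_eq assms L2_spaceD by blast+
  then have "integrable unit_interval (\<lambda>x. (norm (f x))\<^sup>2) = integrable unit_interval (\<lambda>x. (norm (g x))\<^sup>2)"
    using assms(1) by (intro integrable_cong_AE) (auto simp: ae_eq_def)
  then show ?thesis using m assms(2) by (simp add: L2_space_def)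
qed

lemma L2_space_bounded:
  assumes f: "f \<in> borel_measurable unit_interval" and b: "\<And>x. x \<in> {0<..<1} \<Longrightarrow> norm (f x) \<le> B"
  shows "f \<in> L2_space" "L2_norm f \<le> B"
proof -
  interpret finite_measure unit_interval by (rule finite_measure_unit_interval)
  have B: "B \<ge> 0" using order_trans[OF norm_ge_zero b[of "1/2"]] by simp
  have *: "(norm (f x))\<^sup>2 \<le> B\<^sup>2" if "x \<in> {0<..<1}" for x
    using b[OF that] by (intro power_mono) auto
  have i: "integrable unit_interval (\<lambda>x. (norm (f x))\<^sup>2)"
    using f * by (intro integrable_const_bound[of _ "B\<^sup>2"]) (auto intro!: AE_I2)
  then show "f \<in> L2_space" using f by (simp add: L2_space_def)
  have "(\<integral>x. (norm (f x))\<^sup>2 \<partial>unit_interval) \<le> (\<integral>x. B\<^sup>2 \<partial>unit_interval)"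
    using i * by (intro integral_mono) auto
  then have "(\<integral>x. (norm (f x))\<^sup>2 \<partial>unit_interval) \<le> B\<^sup>2"
    using measure_unit_interval by simp
  then show "L2_norm f \<le> B" using B unfolding L2_norm_def by (simp add: real_le_lsqrt)
qed

lemma continuous_on_unit_interval_bounded:
  fixes f :: "real \<Rightarrow> 'a::real_normed_vector"
  assumes "continuous_on {0..1} f"
  obtains B where "\<And>x. x \<in> {0..1} \<Longrightarrow> norm (f x) \<le> B"
proof -
  have "compact (f ` {0..1})" using assms by (intro compact_continuous_image) auto
  then have "bounded (f ` {0..1})" by (rule compact_imp_bounded)
  then show thesis using that unfolding bounded_iff by blast
qed

lemma borel_measurable_continuous_unit_interval:
  fixes f :: "real \<Rightarrow> 'a::{second_countable_topology,real_normed_vector}"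
  assumes "continuous_on {0..1} f"
  shows "f \<in> borel_measurable unit_interval"
  by (intro continuous_imp_measurable_on_sets_lebesgue continuous_on_subset[OF assms]) auto

lemma integrable_continuous_unit_interval:
  fixes f :: "real \<Rightarrow> 'a::{second_countable_topology,banach}"
  assumes "continuous_on {0..1} f"
  shows "integrable unit_interval f"
proof -
  interpret finite_measure unit_interval by (rule finite_measure_unit_interval)
  obtain B where "\<And>x. x \<in> {0..1} \<Longrightarrow> norm (f x) \<le> B"
    using continuous_on_unit_interval_bounded[OF assms] by blast
  then show ?thesis
    using borel_measurable_continuous_unit_interval[OF assms]
    by (intro integrable_const_bound[of _ B] AE_I2) auto
qed

lemma L2_space_continuous:
  assumes "continuous_on {0..1} f"
  shows "f \<in> L2_space"
proof -
  obtain B where "\<And>x. x \<in> {0..1} \<Longrightarrow> norm (f x) \<le> B"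
    using continuous_on_unit_interval_bounded[OF assms] by blast
  then show ?thesis
    using assms by (intro L2_space_bounded(1)[of _ B] borel_measurable_continuous_unit_interval) auto
qed

lemma L2_space_linear:
  assumes "f \<in> L2_space" "bounded_linear L"
  shows "(\<lambda>x. L (f x)) \<in> L2_space"
proof -
  obtain K where K: "K > 0" "\<And>x. norm (L x) \<le> norm x * K"
    using bounded_linear.pos_bounded[OF assms(2)] by blast
  have [measurable]: "f \<in> borel_measurable unit_interval" using L2_spaceD[OF assms(1)] by simp
  have m: "(\<lambda>x. L (f x)) \<in> borel_measurable unit_interval"
    by (rule measurable_compose[OF _ borel_measurable_continuous_onI])
      (auto intro: linear_continuous_on assms)
  have "integrable unit_interval (\<lambda>x. (norm (L (f x)))\<^sup>2)"
  proof (rule Bochner_Integration.integrable_bound)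
    show "integrable unit_interval (\<lambda>x. K\<^sup>2 * (norm (f x))\<^sup>2)"
      using L2_spaceD[OF assms(1)] by (intro integrable_mult_right)
    have "(norm (L (f x)))\<^sup>2 \<le> K\<^sup>2 * (norm (f x))\<^sup>2" for x
      using power_mono[OF K(2), of "f x" 2] by (simp add: power_mult_distrib mult.commute)
    then show "AE x in unit_interval. norm ((norm (L (f x)))\<^sup>2) \<le> norm (K\<^sup>2 * (norm (f x))\<^sup>2)"
      by (intro AE_I2) simp
  qed (use m in measurable)
  then show ?thesis using m by (simp add: L2_space_def)
qed

lemma L2_space_add:
  assumes "f \<in> L2_space" "g \<in> L2_space"
  shows "(\<lambda>x. f x + g x) \<in> L2_space"
proof -
  note [measurable] = L2_spaceD(1)[OF assms(1)] L2_spaceD(1)[OF assms(2)]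
  have "integrable unit_interval (\<lambda>x. (norm (f x + g x))\<^sup>2)"
  proof (rule Bochner_Integration.integrable_bound)
    show "integrable unit_interval (\<lambda>x. 2 * (norm (f x))\<^sup>2 + 2 * (norm (g x))\<^sup>2)"
      using L2_spaceD(2)[OF assms(1)] L2_spaceD(2)[OF assms(2)] by simp
    have "(norm (f x + g x))\<^sup>2 \<le> 2 * (norm (f x))\<^sup>2 + 2 * (norm (g x))\<^sup>2" for x
    proof -
      have "(norm (f x + g x))\<^sup>2 \<le> (norm (f x) + norm (g x))\<^sup>2"
        by (intro power_mono norm_triangle_ineq) simp
      moreover have "0 \<le> (norm (f x) - norm (g x))\<^sup>2" by simp
      ultimately show ?thesis by (simp add: power2_eq_square algebra_simps)
    qed
    then show "AE x in unit_interval. norm ((norm (f x + g x))\<^sup>2)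
        \<le> norm (2 * (norm (f x))\<^sup>2 + 2 * (norm (g x))\<^sup>2)"
      by (intro AE_I2) simp
  qed measurable
  then show ?thesis by (simp add: L2_space_def)
qed

text \<open>Passage from the Bochner integral of the definitions to the gauge integral, in which the
  fundamental theorem of calculus is available. The endpoints carry no mass.\<close>

lemma
  fixes f :: "real \<Rightarrow> 'a::euclidean_space"
  assumes "integrable unit_interval f"
  shows integrable_on_unit_subinterval: "0 \<le> a \<Longrightarrow> b \<le> 1 \<Longrightarrow> f integrable_on {a..b}"
    and lebesgue_integral_unit_interval: "(\<integral>x. f x \<partial>unit_interval) = integral {0..1} f"
proof -
  have ai: "f absolutely_integrable_on {0<..<1}"
    using assms by (simp add: integrable_restrict_space set_integrable_def)
  then have "f integrable_on {0<..<1}" by (rule set_lebesgue_integral_eq_integral(1))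
  then have i: "f integrable_on {0..1}"
    using integrable_on_open_interval[of f 0 1] by (simp add: box_real)
  then show "0 \<le> a \<Longrightarrow> b \<le> 1 \<Longrightarrow> f integrable_on {a..b}"
    using integrable_on_subinterval by fastforce
  show "(\<integral>x. f x \<partial>unit_interval) = integral {0..1} f"
    using set_lebesgue_integral_eq_integral(2)[OF ai] integral_open_interval_real[of 0 1 f]
    by (simp add: integral_restrict_space set_lebesgue_integral_def)
qed

lemma norm_integral_le_lebesgue:
  fixes f :: "real \<Rightarrow> 'a::euclidean_space"
  assumes f: "integrable unit_interval f" and x: "x \<in> {0..1}"
  shows "norm (integral {0..x} f) \<le> (\<integral>x. norm (f x) \<partial>unit_interval)"
proof -
  have i: "f integrable_on {0..x}" "(\<lambda>x. norm (f x)) integrable_on {0..x}"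
      "(\<lambda>x. norm (f x)) integrable_on {0..1}"
    using f x by (auto intro!: integrable_on_unit_subinterval)
  then have "norm (integral {0..x} f) \<le> integral {0..x} (\<lambda>x. norm (f x))"
    by (intro integral_norm_bound_integral) auto
  also have "\<dots> \<le> integral {0..1} (\<lambda>x. norm (f x))"
    using x i by (intro integral_subset_le) auto
  also have "\<dots> = (\<integral>x. norm (f x) \<partial>unit_interval)"
    using f by (intro lebesgue_integral_unit_interval[symmetric]) simp
  finally show ?thesis .
qed

lemma integrable_scaleR_continuous:
  fixes f :: "real \<Rightarrow> 'a::euclidean_space"
  assumes "integrable unit_interval f" "continuous_on {0..1} \<psi>"
  shows "integrable unit_interval (\<lambda>x. \<psi> x *\<^sub>R f x)"
proof -
  obtain B where B: "\<And>x. x \<in> {0..1} \<Longrightarrow> norm (\<psi> x) \<le> B"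
    using continuous_on_unit_interval_bounded[OF assms(2)] by blast
  have [measurable]: "f \<in> borel_measurable unit_interval" "\<psi> \<in> borel_measurable unit_interval"
    using assms borel_measurable_continuous_unit_interval by auto
  show ?thesis
  proof (rule Bochner_Integration.integrable_bound)
    show "integrable unit_interval (\<lambda>x. B *\<^sub>R f x)" using assms by simp
    show "AE x in unit_interval. norm (\<psi> x *\<^sub>R f x) \<le> norm (B *\<^sub>R f x)"
    proof (rule AE_I2)
      fix x assume "x \<in> space unit_interval"
      then have "\<bar>\<psi> x\<bar> \<le> \<bar>B\<bar>" using B[of x] by auto
      then show "norm (\<psi> x *\<^sub>R f x) \<le> norm (B *\<^sub>R f x)" by (simp add: mult_right_mono)
    qed
  qed measurable
qed

section \<open>Smooth test functions\<close>

text \<open>The regularity half of \<open>test_function\<close>, split off because the building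
  blocks of bumps have no compact support.\<close>

definition smooth :: "(real \<Rightarrow> real) \<Rightarrow> bool" where
  "smooth f \<longleftrightarrow> (\<forall>n x. (deriv ^^ n) f field_differentiable at x)"

text \<open>A class closed under differentiation contains all iterated derivatives of its members,
  so no formula for an nth derivative is ever needed.\<close>

lemma smooth_coinduct:
  assumes "S f" and step: "\<And>g. S g \<Longrightarrow> \<exists>g'. (\<forall>x. (g has_field_derivative g' x) (at x)) \<and> S g'"
  shows "smooth f"
proof -
  have *: "(\<forall>x. g field_differentiable at x) \<and> S (deriv g)" if g: "S g" for g
  proof -
    obtain g' where g': "\<And>x. (g has_field_derivative g' x) (at x)" "S g'" using step[OF g] by blast
    then have "deriv g = g'" by (intro ext DERIV_imp_deriv)
    then show ?thesis using g' by (auto simp: field_differentiable_def)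
  qed
  have "S ((deriv ^^ n) f)" for n
    by (induction n) (use * assms(1) in auto)
  then show ?thesis using * by (simp add: smooth_def)
qed

lemma smooth_deriv:
  assumes "smooth f"
  shows "(f has_field_derivative deriv f x) (at x)" "smooth (deriv f)"
proof -
  have "(deriv ^^ 0) f field_differentiable at x" using assms unfolding smooth_def by blast
  then show "(f has_field_derivative deriv f x) (at x)" by (simp add: DERIV_deriv_iff_field_differentiable)
  have "(deriv ^^ n) (deriv f) field_differentiable at y" for n y
    using assms[unfolded smooth_def, rule_format, of "Suc n" y] by (simp add: funpow_swap1)
  then show "smooth (deriv f)" by (simp add: smooth_def)
qed

lemma smooth_continuous: "smooth f \<Longrightarrow> continuous_on A f"
  using DERIV_isCont smooth_deriv(1) by (metis continuous_at_imp_continuous_on)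

lemma smooth_add:
  assumes "smooth f" "smooth g"
  shows "smooth (\<lambda>x. f x + g x)"
proof (rule smooth_coinduct[where S = "\<lambda>h. \<exists>u v. smooth u \<and> smooth v \<and> h = (\<lambda>x. u x + v x)"])
  fix h assume "\<exists>u v. smooth u \<and> smooth v \<and> h = (\<lambda>x. u x + v x)"
  then obtain u v where "smooth u" "smooth v" "h = (\<lambda>x. u x + v x)" by blast
  then show "\<exists>h'. (\<forall>x. (h has_field_derivative h' x) (at x)) \<and>
      (\<exists>u v. smooth u \<and> smooth v \<and> h' = (\<lambda>x. u x + v x))"
    by (intro exI[of _ "\<lambda>x. deriv u x + deriv v x"] conjI exI[of _ "deriv u"] exI[of _ "deriv v"])
      (auto intro!: DERIV_add smooth_deriv)
qed (use assms in blast)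

lemma smooth_affine:
  assumes "smooth f"
  shows "smooth (\<lambda>x. c * f (p * x + q))"
proof (rule smooth_coinduct[where S = "\<lambda>h. \<exists>u c. smooth u \<and> h = (\<lambda>x. c * u (p * x + q))"])
  fix h assume "\<exists>u c. smooth u \<and> h = (\<lambda>x. c * u (p * x + q))"
  then obtain u c where u: "smooth u" "h = (\<lambda>x. c * u (p * x + q))" by blast
  have "(h has_field_derivative c * p * deriv u (p * x + q)) (at x)" for x
    unfolding u(2) by (rule derivative_eq_intros DERIV_chain2[OF smooth_deriv(1)[OF u(1)]] refl | simp)+
  moreover have "smooth (deriv u)" using u smooth_deriv by blast
  ultimately show "\<exists>h'. (\<forall>x. (h has_field_derivative h' x) (at x)) \<and>
      (\<exists>u c. smooth u \<and> h' = (\<lambda>x. c * u (p * x + q)))"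
    by (intro exI[of _ "\<lambda>x. c * p * deriv u (p * x + q)"]) auto
qed (use assms in blast)

text \<open>By the product rule these sums are closed under differentiation, unlike products alone.\<close>

inductive sum_of_products :: "(real \<Rightarrow> real) \<Rightarrow> bool" where
  product: "smooth u \<Longrightarrow> smooth v \<Longrightarrow> sum_of_products (\<lambda>x. u x * v x)"
| sum: "sum_of_products u \<Longrightarrow> sum_of_products v \<Longrightarrow> sum_of_products (\<lambda>x. u x + v x)"

lemma smooth_mult:
  assumes "smooth f" "smooth g"
  shows "smooth (\<lambda>x. f x * g x)"
proof (rule smooth_coinduct[where S = sum_of_products])
  fix h assume "sum_of_products h"
  then show "\<exists>h'. (\<forall>x. (h has_field_derivative h' x) (at x)) \<and> sum_of_products h'"
  proof induction
    case (product u v)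
    have "((\<lambda>x. u x * v x) has_field_derivative deriv u x * v x + deriv v x * u x) (at x)" for x
      by (intro DERIV_mult smooth_deriv product)
    moreover have "sum_of_products (\<lambda>x. deriv u x * v x + deriv v x * u x)"
      by (intro sum_of_products.intros smooth_deriv product)
    ultimately show ?case by (intro exI conjI allI)
  next
    case (sum u v)
    then obtain u' v' where "\<And>x. (u has_field_derivative u' x) (at x)" "sum_of_products u'"
      "\<And>x. (v has_field_derivative v' x) (at x)" "sum_of_products v'" by blast
    then show ?case
      by (intro exI[of _ "\<lambda>x. u' x + v' x"]) (auto intro!: DERIV_add sum_of_products.sum)
  qed
qed (use assms in \<open>simp add: sum_of_products.product\<close>)

text \<open>\<open>p (1 / x) exp (- 1 / x)\<close>, extended by zero; the derivative has the same form.\<close>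

definition flat :: "real poly \<Rightarrow> real \<Rightarrow> real" where
  "flat p x = (if x > 0 then poly p (1 / x) * exp (- (1 / x)) else 0)"

lemma poly_exp_tendsto_0: "((\<lambda>t. poly p t * exp (- t)) \<longlongrightarrow> (0::real)) at_top"
proof -
  have "((\<lambda>t. \<Sum>i\<le>degree p. coeff p i * (t ^ i / exp t)) \<longlongrightarrow> (\<Sum>i\<le>degree p. coeff p i * 0)) at_top"
    by (intro tendsto_sum tendsto_mult tendsto_const tendsto_power_div_exp_0)
  then show ?thesis
    by (simp add: poly_altdef exp_minus sum_distrib_right divide_inverse mult.assoc)
qed

text \<open>This is the difference quotient of \<open>flat p\<close> at 0. On the right the factor
  1/h is absorbed into the polynomial, and exponential decay in 1/h wins.\<close>

lemma flat_over_tendsto_0: "((\<lambda>h. flat p h / h) \<longlongrightarrow> 0) (at 0)"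
  unfolding filterlim_at_split
proof
  have "\<forall>\<^sub>F h in at_left 0. flat p h / h = (0::real)"
    by (auto simp: flat_def eventually_at_filter)
  then show "((\<lambda>h. flat p h / h) \<longlongrightarrow> 0) (at_left 0)"
    by (rule tendsto_eventually)
  have "((\<lambda>h. poly ([:0, 1:] * p) (inverse h) * exp (- inverse h)) \<longlongrightarrow> (0::real)) (at_right 0)"
    by (rule filterlim_compose[OF poly_exp_tendsto_0 filterlim_inverse_at_top_right])
  moreover have "\<forall>\<^sub>F h in at_right 0. poly ([:0, 1:] * p) (inverse h) * exp (- inverse h) = flat p h / h"
    by (auto simp: flat_def eventually_at_filter field_simps)
  ultimately show "((\<lambda>h. flat p h / h) \<longlongrightarrow> 0) (at_right 0)"
    by (rule Lim_transform_eventually)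
qed

text \<open>With t = 1/x one has d/dx = - t^2 d/dt, and p(t) exp(-t) has t-derivative (p' - p)(t)
  exp(-t); hence the polynomial t^2 (p - p').\<close>

lemma flat_has_derivative:
  "(flat p has_field_derivative flat ([:0, 0, 1:] * (p - pderiv p)) x) (at x)"
proof -
  consider "x < 0" | "x = 0" | "x > 0" by linarith
  then show ?thesis
  proof cases
    case 1
    have "((\<lambda>x. 0) has_field_derivative (0::real)) (at x)" by simp
    then have "(flat p has_field_derivative 0) (at x)"
      by (rule has_field_derivative_transform_within_open[of _ _ _ "{..<0}"]) (use 1 in \<open>auto simp: flat_def\<close>)
    then show ?thesis using 1 by (simp add: flat_def)
  next
    case 2
    then show ?thesis using flat_over_tendsto_0[of p]
      by (simp add: DERIV_def flat_def[of _ 0])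
  next
    case 3
    have "((\<lambda>x. poly p (1 / x) * exp (- (1 / x))) has_field_derivative
        flat ([:0, 0, 1:] * (p - pderiv p)) x) (at x)"
      using 3 by (auto intro!: derivative_eq_intros DERIV_chain2[OF poly_DERIV]
          simp: flat_def field_simps power2_eq_square)
    then show ?thesis
      by (rule has_field_derivative_transform_within_open[of _ _ _ "{0<..}"]) (use 3 in \<open>auto simp: flat_def\<close>)
  qed
qed

lemma smooth_flat: "smooth (flat p)"
  by (rule smooth_coinduct[where S = "\<lambda>f. \<exists>p. f = flat p"]) (use flat_has_derivative in blast)+

text \<open>Two flat functions, one rising from \<open>a\<close> and one falling to
  \<open>b\<close>, have a product supported in the interval and positive at its midpoint. A
  continuous nonnegative function with integral 0 would vanish there, so the product can be
  normalised.\<close>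

lemma normalized_bump:
  fixes a b :: real
  assumes "a < b"
  obtains \<eta> where "smooth \<eta>" "\<And>x. 0 \<le> \<eta> x" "\<And>x. x \<notin> {a..b} \<Longrightarrow> \<eta> x = 0" "(\<eta> has_integral 1) {a..b}"
proof -
  define \<beta> where "\<beta> = (\<lambda>x. flat 1 (x - a) * flat 1 (b - x))"
  have s: "smooth \<beta>"
    using smooth_mult[OF smooth_affine[OF smooth_flat, of 1 1 1 "-a"]
        smooth_affine[OF smooth_flat, of 1 1 "-1" b]]
    by (simp add: \<beta>_def)
  have nn: "0 \<le> \<beta> x" for x by (simp add: \<beta>_def flat_def)
  have c: "continuous_on {a..b} \<beta>" using s by (rule smooth_continuous)
  have "integral {a..b} \<beta> \<noteq> 0"
  proof
    assume "integral {a..b} \<beta> = 0"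
    then have "\<forall>x\<in>{a..b}. \<beta> x = 0"
      using integral_eq_0_iff[OF c assms] nn by blast
    then have "\<beta> ((a + b) / 2) = 0" using assms by simp
    then show False using assms by (simp add: \<beta>_def flat_def field_simps)
  qed
  moreover have "(\<beta> has_integral integral {a..b} \<beta>) {a..b}"
    using c by (simp add: integrable_continuous_real integrable_integral)
  moreover have "0 \<le> integral {a..b} \<beta>"
    using nn c by (intro integral_nonneg integrable_continuous_real) auto
  ultimately show thesis
    using nn smooth_affine[OF s, of "1 / integral {a..b} \<beta>" 1 0]
      has_integral_mult_right[of \<beta> "integral {a..b} \<beta>" "{a..b}" "1 / integral {a..b} \<beta>"]
    by (intro that[of "\<lambda>x. 1 / integral {a..b} \<beta> * \<beta> x"]) (auto simp: \<beta>_def flat_def)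
qed

section \<open>Test functions and the du Bois-Reymond lemma\<close>

text \<open>The complement of the support is open and contains both endpoints, so the derivative
  vanishes there as well. This removes the boundary terms of two integrations by parts.\<close>

lemma test_functionD:
  assumes "test_function \<psi>"
  shows "smooth \<psi>" "\<psi> 0 = 0" "\<psi> 1 = 0"
    "deriv \<psi> 0 = 0" "deriv \<psi> 1 = 0"
proof -
  obtain K where K: "compact K" "K \<subseteq> {0<..<1}" "\<And>x. x \<notin> K \<Longrightarrow> \<psi> x = 0"
    using assms unfolding test_function_def by blast
  show "smooth \<psi>" using assms unfolding test_function_def smooth_def by blast
  have z: "\<psi> x = 0 \<and> deriv \<psi> x = 0" if "x \<notin> K" for x
  proof -
    have "((\<lambda>x. 0) has_field_derivative (0::real)) (at x)" by simp
    then have "(\<psi> has_field_derivative 0) (at x)"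
      by (rule has_field_derivative_transform_within_open[of _ _ _ "- K"])
        (use K that in \<open>auto simp: compact_imp_closed open_Compl\<close>)
    then show ?thesis using K that by (simp add: DERIV_imp_deriv)
  qed
  show "\<psi> 0 = 0" "\<psi> 1 = 0" "deriv \<psi> 0 = 0" "deriv \<psi> 1 = 0"
    using z[of 0] z[of 1] K(2) by (force+)
qed

text \<open>Mean zero makes the primitive return to 0 at \<open>b\<close>, so it has compact
  support.\<close>

lemma test_function_primitive:
  assumes \<eta>: "smooth \<eta>" and supp: "\<And>x. x \<notin> {a..b} \<Longrightarrow> \<eta> x = 0" and ab: "0 < a" "a \<le> b" "b < 1"
    and 0: "(\<eta> has_integral 0) {a..b}"
  obtains \<psi> where "test_function \<psi>" "deriv \<psi> = \<eta>"
proof -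
  define \<psi> where "\<psi> x = integral {0..x} \<eta>" for x
  have z1: "\<psi> x = 0" if "x < a" for x
  proof -
    have "integral {0..x} \<eta> = integral {0..x} (\<lambda>_. 0)"
      using supp that by (intro Henstock_Kurzweil_Integration.integral_cong) auto
    then show ?thesis by (simp add: \<psi>_def)
  qed
  have z2: "\<psi> x = 0" if "x > b" for x
  proof -
    have "(\<eta> has_integral 0) {0..x}"
      by (rule has_integral_on_superset[OF 0]) (use supp that ab in auto)
    then show ?thesis by (simp add: \<psi>_def integral_unique)
  qed
  have d: "(\<psi> has_field_derivative \<eta> x) (at x)" for x
  proof (cases "x < a")
    case True
    have "((\<lambda>x. 0) has_field_derivative (0::real)) (at x)" by simp
    then have "(\<psi> has_field_derivative 0) (at x)"
      by (rule has_field_derivative_transform_within_open[of _ _ _ "{..<a}"]) (use True z1 in auto)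
    then show ?thesis using True supp by simp
  next
    case False
    \<comment> \<open>The interval reaches beyond \<open>x\<close> so that \<open>x\<close> is
      interior and the derivative is two-sided.\<close>
    have "(\<psi> has_real_derivative \<eta> x) (at x within {0..x+1})"
      unfolding \<psi>_def using False ab by (intro integral_has_real_derivative smooth_continuous \<eta>) auto
    then show ?thesis using False ab by (subst (asm) at_within_interior) auto
  qed
  then have d': "deriv \<psi> = \<eta>" by (intro ext DERIV_imp_deriv)
  have "(deriv ^^ n) \<psi> field_differentiable at x" for n x
  proof (cases n)
    case 0
    then show ?thesis using d by (auto simp: field_differentiable_def)
  next
    case (Suc m)
    then show ?thesis using \<eta> d' by (simp add: smooth_def funpow_swap1)
  qed
  then have "test_function \<psi>"
    unfolding test_function_def
    using z1 z2 ab by (intro conjI exI[of _ "{a..b}"]) (auto simp: not_le)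
  then show thesis using d' that by blast
qed

text \<open>If \<open>q t < q s\<close>, a unit bump near \<open>s\<close> minus a unit bump near
  \<open>t\<close> has mean zero, so it is the derivative of a test function. Where the bumps live,
  \<open>q\<close> stays within a quarter of the gap of \<open>q s\<close> and \<open>q t\<close>
  respectively, so the integral against \<open>q\<close> is at least half the gap instead of
  0.\<close>

lemma real_du_Bois_Reymond:
  fixes q :: "real \<Rightarrow> real"
  assumes q: "continuous_on {0..1} q"
    and int: "\<And>\<psi>. test_function \<psi> \<Longrightarrow> integral {0..1} (\<lambda>x. deriv \<psi> x * q x) = 0"
    and s: "s \<in> {0<..<1}" and t: "t \<in> {0<..<1}"
  shows "q s \<le> q t"
proof (rule ccontr)
  assume "\<not> q s \<le> q t"
  then have lt: "q t < q s" by simp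
  define m where "m = (q s + q t) / 2"
  have near: "\<exists>a b. 0 < a \<and> a < b \<and> b < 1 \<and> (\<forall>y\<in>{a..b}. \<bar>q y - q x\<bar> \<le> (q s - q t) / 4)"
    if x: "x \<in> {0<..<1}" for x
  proof -
    obtain e where e: "e > 0" "\<And>y. y \<in> {0..1} \<Longrightarrow> dist y x < e \<Longrightarrow> dist (q y) (q x) < (q s - q t) / 4"
      using q x lt unfolding continuous_on_iff
      by (metis atLeastAtMost_iff diff_gt_0_iff_gt divide_pos_pos greaterThanLessThan_iff less_le zero_less_numeral)
    define r where "r = min (e / 2) (min (x / 2) ((1 - x) / 2))"
    have r: "r > 0" "r < e" "x - r > 0" "x + r < 1" using e x by (auto simp: r_def min_def field_simps)
    then have "\<forall>y\<in>{x - r..x + r}. \<bar>q y - q x\<bar> \<le> (q s - q t) / 4"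
      using e(2) by (auto simp: dist_real_def intro!: less_imp_le)
    then show ?thesis using r by (intro exI[of _ "x - r"] exI[of _ "x + r"]) auto
  qed
  obtain a b where ab: "0 < a" "a < b" "b < 1" "\<And>y. y \<in> {a..b} \<Longrightarrow> \<bar>q y - q s\<bar> \<le> (q s - q t) / 4"
    using near[OF s] by blast
  obtain a' b' where ab': "0 < a'" "a' < b'" "b' < 1" "\<And>y. y \<in> {a'..b'} \<Longrightarrow> \<bar>q y - q t\<bar> \<le> (q s - q t) / 4"
    using near[OF t] by blast
  obtain \<eta> where \<eta>: "smooth \<eta>" "\<And>x. 0 \<le> \<eta> x" "\<And>x. x \<notin> {a..b} \<Longrightarrow> \<eta> x = 0" "(\<eta> has_integral 1) {a..b}"
    using normalized_bump[OF ab(2)] by blast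
  obtain \<eta>' where \<eta>': "smooth \<eta>'" "\<And>x. 0 \<le> \<eta>' x" "\<And>x. x \<notin> {a'..b'} \<Longrightarrow> \<eta>' x = 0" "(\<eta>' has_integral 1) {a'..b'}"
    using normalized_bump[OF ab'(2)] by blast
  have sm: "smooth (\<lambda>x. \<eta> x - \<eta>' x)"
    using smooth_add[OF \<eta>(1) smooth_affine[OF \<eta>'(1), of "-1" 1 0]] by simp
  have i: "(\<eta> has_integral 1) S" "(\<eta>' has_integral 1) S" if "{min a a'..max b b'} \<subseteq> S" for S
  proof -
    have "{a..b} \<subseteq> S" "{a'..b'} \<subseteq> S"
      by (rule order_trans[OF _ that], simp)+
    then show "(\<eta> has_integral 1) S" "(\<eta>' has_integral 1) S"
      by (auto intro!: has_integral_on_superset[OF \<eta>(4)] has_integral_on_superset[OF \<eta>'(4)] \<eta>(3) \<eta>'(3))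
  qed
  have "((\<lambda>x. \<eta> x - \<eta>' x) has_integral 0) {min a a'..max b b'}"
    using has_integral_diff[OF i, of "{min a a'..max b b'}"] by simp
  then obtain \<psi> where \<psi>: "test_function \<psi>" "deriv \<psi> = (\<lambda>x. \<eta> x - \<eta>' x)"
  proof (rule test_function_primitive[OF sm, rotated 4])
    fix x assume x: "x \<notin> {min a a'..max b b'}"
    then have "x \<notin> {a..b}" "x \<notin> {a'..b'}" by auto
    then show "\<eta> x - \<eta>' x = 0" using \<eta>(3) \<eta>'(3) by (metis diff_self)
  qed (use ab ab' in auto)
  have sub: "{min a a'..max b b'} \<subseteq> {0..1}" using ab ab' by auto
  have "((\<lambda>x. \<eta> x * (q s - (q s - q t) / 4) - \<eta>' x * (q t + (q s - q t) / 4)) has_integral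
      1 * (q s - (q s - q t) / 4) - 1 * (q t + (q s - q t) / 4)) {0..1}"
    by (rule has_integral_diff[OF has_integral_mult_left[OF i(1)[OF sub]] has_integral_mult_left[OF i(2)[OF sub]]])
  moreover have "((\<lambda>x. deriv \<psi> x * q x) has_integral 0) {0..1}"
  proof -
    have "(\<lambda>x. deriv \<psi> x * q x) integrable_on {0..1}"
      unfolding \<psi>(2) by (rule integrable_continuous_real[OF continuous_on_mult[OF smooth_continuous[OF sm] q]])
    then show ?thesis using int[OF \<psi>(1)] by (metis integrable_integral)
  qed
  moreover have "\<eta> x * (q s - (q s - q t) / 4) - \<eta>' x * (q t + (q s - q t) / 4) \<le> deriv \<psi> x * q x"
    if "x \<in> {0..1}" for x
  proof -
    have "q s - (q s - q t) / 4 \<le> q x" if "x \<in> {a..b}"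
      using ab(4)[OF that] unfolding abs_le_iff by linarith
    then have "\<eta> x * (q s - (q s - q t) / 4) \<le> \<eta> x * q x"
      using \<eta>(2)[of x] \<eta>(3)[of x] by (metis mult_left_mono mult_zero_left order_refl)
    moreover have "q x \<le> q t + (q s - q t) / 4" if "x \<in> {a'..b'}"
      using ab'(4)[OF that] unfolding abs_le_iff by linarith
    then have "\<eta>' x * q x \<le> \<eta>' x * (q t + (q s - q t) / 4)"
      using \<eta>'(2)[of x] \<eta>'(3)[of x] by (metis mult_left_mono mult_zero_left order_refl)
    ultimately show ?thesis unfolding \<psi>(2) by (simp add: algebra_simps)
  qed
  ultimately have "1 * (q s - (q s - q t) / 4) - 1 * (q t + (q s - q t) / 4) \<le> 0"
    by (rule has_integral_le)
  then show False using lt by (simp add: field_simps)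
qed

text \<open>The real inequality, used in both orders for each component, gives constancy on the open
  interval; continuity adds the endpoints.\<close>

lemma du_Bois_Reymond:
  fixes q :: "real \<Rightarrow> 'a::euclidean_space"
  assumes q: "continuous_on {0..1} q"
    and int: "\<And>\<psi>. test_function \<psi> \<Longrightarrow> integral {0..1} (\<lambda>x. deriv \<psi> x *\<^sub>R q x) = 0"
    and x: "x \<in> {0..1}"
  shows "q x = q 0"
proof -
  have le: "q s \<bullet> b \<le> q t \<bullet> b" if "s \<in> {0<..<1}" "t \<in> {0<..<1}" for s t b
  proof (rule real_du_Bois_Reymond[OF _ _ that])
    show "continuous_on {0..1} (\<lambda>x. q x \<bullet> b)" by (intro continuous_intros q)
    fix \<psi> assume \<psi>: "test_function \<psi>"
    have "(\<lambda>x. deriv \<psi> x *\<^sub>R q x) integrable_on {0..1}"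
      using test_functionD(1)[OF \<psi>]
      by (intro integrable_continuous_real continuous_intros q smooth_continuous smooth_deriv)
    from integral_linear[OF this bounded_linear_inner_left[of b]]
    show "integral {0..1} (\<lambda>x. deriv \<psi> x * (q x \<bullet> b)) = 0"
      using int[OF \<psi>] by (simp add: o_def)
  qed
  have *: "q s = q (1/2)" if "s \<in> {0<..<1}" for s
    by (rule euclidean_eqI, rule antisym[OF le le]) (use that in simp_all)
  have "q x = q (1/2)" if "x \<in> {0..1}" for x
  proof (rule continuous_constant_on_closure[of "{0<..<1}" q])
    show "continuous_on (closure {0<..<1}) q" using q by simp
    show "q y = q (1/2)" if "y \<in> {0<..<1}" for y using that by (rule *)
    show "x \<in> closure {0<..<1}" using that by simp
  qed
  from this[OF x] this[of 0] show ?thesis by simp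
qed

section \<open>Second weak derivatives\<close>

lemma integral_by_parts_vanishing:
  fixes F F' :: "real \<Rightarrow> 'a::euclidean_space"
  assumes \<psi>: "smooth \<psi>" "\<psi> 0 = 0" "\<psi> 1 = 0"
    and F: "\<And>x. x \<in> {0..1} \<Longrightarrow> (F has_vector_derivative F' x) (at x within {0..1})"
    and F': "continuous_on {0..1} F'"
  shows "integral {0..1} (\<lambda>x. deriv \<psi> x *\<^sub>R F x) = - integral {0..1} (\<lambda>x. \<psi> x *\<^sub>R F' x)"
proof -
  have "(\<lambda>x. \<psi> x *\<^sub>R F' x) integrable_on {0..1}"
    by (intro integrable_continuous_real continuous_intros smooth_continuous \<psi> F')
  then have i: "((\<lambda>x. \<psi> x *\<^sub>R F' x) has_integral
      (\<psi> 1 *\<^sub>R F 1 - \<psi> 0 *\<^sub>R F 0 - (- integral {0..1} (\<lambda>x. \<psi> x *\<^sub>R F' x)))) {0..1}"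
    using \<psi> by (simp add: has_integral_integrable_integral)
  have "((\<lambda>x. deriv \<psi> x *\<^sub>R F x) has_integral (- integral {0..1} (\<lambda>x. \<psi> x *\<^sub>R F' x))) {0..1}"
  proof (rule integration_by_parts_interior[OF bounded_bilinear_scaleR _ _ _ _ _ i])
    show "continuous_on {0..1} F" using F by (rule continuous_on_vector_derivative)
    show "(F has_vector_derivative F' x) (at x)" if "x \<in> {0<..<1}" for x
      using F[of x] that by (simp add: at_within_Icc_at)
    show "(\<psi> has_vector_derivative deriv \<psi> x) (at x)" for x
      using smooth_deriv(1)[OF \<psi>(1)] by (simp add: has_real_derivative_iff_has_vector_derivative)
  qed (use \<psi> smooth_continuous in auto)
  then show ?thesis by (rule integral_unique)
qed

text \<open>The primitive of an integrable \<open>g\<close> need not be differentiable everywhere,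
  so the classical rule does not apply. Instead Fubini's theorem exchanges the integrals over the
  triangle t <= x; the kernel is dominated by a multiple of \<open>g t\<close>, which is integrable
  over the square because the measure is finite.\<close>

lemma integral_by_parts_primitive:
  fixes g :: "real \<Rightarrow> 'a::euclidean_space"
  assumes \<psi>: "smooth \<psi>" "\<psi> 1 = 0" and g: "integrable unit_interval g"
  shows "integral {0..1} (\<lambda>x. deriv \<psi> x *\<^sub>R integral {0..x} g) = - integral {0..1} (\<lambda>x. \<psi> x *\<^sub>R g x)"
proof -
  interpret finite_measure unit_interval by (rule finite_measure_unit_interval)
  interpret P: pair_sigma_finite unit_interval unit_interval ..
  have cd: "continuous_on {0..1} (deriv \<psi>)"
    using \<psi>(1) smooth_continuous smooth_deriv(2) by blast
  obtain B where B: "\<And>x. x \<in> {0..1} \<Longrightarrow> norm (deriv \<psi> x) \<le> B"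
    using continuous_on_unit_interval_bounded[OF cd] by blast
  define K where "K x t = (if t \<le> x then deriv \<psi> x else 0) *\<^sub>R g t" for x t
  have [measurable]: "(\<lambda>x. x) \<in> borel_measurable unit_interval"
    "deriv \<psi> \<in> borel_measurable unit_interval" "g \<in> borel_measurable unit_interval"
    using g cd by (auto intro: borel_measurable_continuous_unit_interval)
  have [measurable]: "(\<lambda>p. fst p) \<in> borel_measurable (unit_interval \<Otimes>\<^sub>M unit_interval)"
    "(\<lambda>p. snd p) \<in> borel_measurable (unit_interval \<Otimes>\<^sub>M unit_interval)"
    "(\<lambda>p. deriv \<psi> (fst p)) \<in> borel_measurable (unit_interval \<Otimes>\<^sub>M unit_interval)"
    "(\<lambda>p. g (snd p)) \<in> borel_measurable (unit_interval \<Otimes>\<^sub>M unit_interval)"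
    by (rule measurable_compose[OF measurable_fst] measurable_compose[OF measurable_snd], measurable)+
  have ig: "integrable (unit_interval \<Otimes>\<^sub>M unit_interval) (\<lambda>p. g (snd p))"
    using g by (intro P.Fubini_integrable) auto
  have iK: "integrable (unit_interval \<Otimes>\<^sub>M unit_interval) (\<lambda>(x, t). K x t)"
  proof (rule Bochner_Integration.integrable_bound)
    show "integrable (unit_interval \<Otimes>\<^sub>M unit_interval) (\<lambda>p. B *\<^sub>R g (snd p))"
      using ig by simp
    show "(\<lambda>(x, t). K x t) \<in> borel_measurable (unit_interval \<Otimes>\<^sub>M unit_interval)"
      unfolding K_def case_prod_beta by measurable
    show "AE p in unit_interval \<Otimes>\<^sub>M unit_interval. norm (case p of (x, t) \<Rightarrow> K x t) \<le> norm (B *\<^sub>R g (snd p))"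
    proof (rule AE_I2)
      fix p assume "p \<in> space (unit_interval \<Otimes>\<^sub>M unit_interval)"
      then have "\<bar>deriv \<psi> (fst p)\<bar> \<le> \<bar>B\<bar>"
        using B[of "fst p"] by (auto simp: space_pair_measure)
      then show "norm (case p of (x, t) \<Rightarrow> K x t) \<le> norm (B *\<^sub>R g (snd p))"
        by (auto simp: K_def case_prod_beta mult_right_mono)
    qed
  qed
  have inner_t: "(\<integral>t. K x t \<partial>unit_interval) = deriv \<psi> x *\<^sub>R integral {0..x} g"
    if x: "x \<in> {0<..<1}" for x
  proof -
    have i: "integrable unit_interval (\<lambda>t. (if t \<le> x then 1 else 0 :: real) *\<^sub>R g t)"
      by (rule Bochner_Integration.integrable_bound[OF g]) (measurable, use x in auto)
    have "(\<integral>t. K x t \<partial>unit_interval) = (\<integral>t. deriv \<psi> x *\<^sub>R ((if t \<le> x then 1 else 0) *\<^sub>R g t) \<partial>unit_interval)"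
      by (intro Bochner_Integration.integral_cong) (auto simp: K_def)
    also have "\<dots> = deriv \<psi> x *\<^sub>R integral {0..1} (\<lambda>t. (if t \<le> x then 1 else 0 :: real) *\<^sub>R g t)"
      by (simp only: integral_scaleR_right lebesgue_integral_unit_interval[OF i])
    also have "integral {0..1} (\<lambda>t. (if t \<le> x then 1 else 0 :: real) *\<^sub>R g t)
        = integral {0..1} (\<lambda>t. if t \<in> {0..x} then g t else 0)"
      by (intro Henstock_Kurzweil_Integration.integral_cong) auto
    also have "\<dots> = integral {0..x} g"
      using x unfolding integral_restrict_Int by (simp add: Int_absorb2)
    finally show ?thesis .
  qed
  have inner_x: "(\<integral>x. K x t \<partial>unit_interval) = - \<psi> t *\<^sub>R g t" if t: "t \<in> {0<..<1}" for t
  proof -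
    have i: "integrable unit_interval (\<lambda>x. if t \<le> x then deriv \<psi> x else 0)"
    proof (rule integrable_const_bound[of _ "\<bar>B\<bar>"])
      have "norm (deriv \<psi> x) \<le> \<bar>B\<bar>" if "x \<in> {0..1}" for x using B[OF that] by simp
      then show "AE x in unit_interval. norm (if t \<le> x then deriv \<psi> x else 0) \<le> \<bar>B\<bar>"
        by (intro AE_I2) auto
    qed (measurable, use t in auto)
    have "(deriv \<psi> has_integral (\<psi> 1 - \<psi> t)) {t..1}"
      using t smooth_deriv(1)[OF \<psi>(1)]
      by (intro fundamental_theorem_of_calculus)
        (auto simp: has_real_derivative_iff_has_vector_derivative[symmetric] intro: has_field_derivative_at_within)
    then have "integral {t..1} (deriv \<psi>) = - \<psi> t" using \<psi>(2) by (simp add: integral_unique)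
    moreover have "integral {0..1} (\<lambda>x. if t \<le> x then deriv \<psi> x else 0)
        = integral {0..1} (\<lambda>x. if x \<in> {t..1} then deriv \<psi> x else 0)"
      by (intro Henstock_Kurzweil_Integration.integral_cong) auto
    moreover have "\<dots> = integral {t..1} (deriv \<psi>)"
      using t unfolding integral_restrict_Int by (simp add: Int_absorb2)
    ultimately show ?thesis
      using lebesgue_integral_unit_interval[OF i] unfolding K_def
      by (subst integral_scaleR_left) (use i in auto)
  qed
  have G: "continuous_on {0..1} (\<lambda>x. integral {0..x} g)"
    using g by (intro indefinite_integral_continuous_1 integrable_on_unit_subinterval) auto
  have "integral {0..1} (\<lambda>x. deriv \<psi> x *\<^sub>R integral {0..x} g)
      = (\<integral>x. deriv \<psi> x *\<^sub>R integral {0..x} g \<partial>unit_interval)"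
    by (intro lebesgue_integral_unit_interval[symmetric] integrable_scaleR_continuous cd
        integrable_continuous_unit_interval G)
  also have "\<dots> = (\<integral>x. \<integral>t. K x t \<partial>unit_interval \<partial>unit_interval)"
    by (intro Bochner_Integration.integral_cong refl inner_t[symmetric]) auto
  also have "\<dots> = (\<integral>t. \<integral>x. K x t \<partial>unit_interval \<partial>unit_interval)"
    using P.Fubini_integral[OF iK] by simp
  also have "\<dots> = (\<integral>t. - (\<psi> t *\<^sub>R g t) \<partial>unit_interval)"
    by (intro Bochner_Integration.integral_cong refl) (use inner_x in auto)
  also have "\<dots> = - integral {0..1} (\<lambda>x. \<psi> x *\<^sub>R g x)"
    using lebesgue_integral_unit_interval[OF integrable_scaleR_continuous[OF g smooth_continuous[OF \<psi>(1)]]]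
    by simp
  finally show ?thesis .
qed

text \<open>One integration by parts on each side shifts everything onto the first derivative of the
  test function. The weak equation then says that \<open>F'\<close> minus the primitive of
  \<open>g\<close> is orthogonal to all such derivatives, that is, constant.\<close>

lemma has_weak_deriv_2_iff:
  assumes f: "C1_representative f F F'" and g: "g \<in> L2_space"
  shows "has_weak_deriv 2 f g \<longleftrightarrow> (\<forall>x\<in>{0..1}. F' x = F' 0 + integral {0..x} g)"
proof -
  have ae: "AE x in unit_interval. f x = F x" and c': "continuous_on {0..1} F'"
    and d: "\<And>x. x \<in> {0..1} \<Longrightarrow> (F has_vector_derivative F' x) (at x within {0..1})"
    using f by (auto simp: C1_representative_def ae_eq_def)
  have cF: "continuous_on {0..1} F" using d by (rule continuous_on_vector_derivative)
  note ig = integrable_L2[OF g]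
  define G where "G x = integral {0..x} g" for x
  have cG: "continuous_on {0..1} G"
    unfolding G_def using ig by (intro indefinite_integral_continuous_1 integrable_on_unit_subinterval) auto
  \<comment> \<open>The left integral equals minus that of \<open>deriv \<psi>\<close> against
    \<open>F'\<close>, the right one minus that against \<open>G\<close>.\<close>
  have key: "((\<integral>x. (deriv ^^ 2) \<psi> x *\<^sub>R f x \<partial>unit_interval) = (-1) ^ 2 *\<^sub>R (\<integral>x. \<psi> x *\<^sub>R g x \<partial>unit_interval))
      \<longleftrightarrow> integral {0..1} (\<lambda>x. deriv \<psi> x *\<^sub>R (F' x - G x)) = 0" if "test_function \<psi>" for \<psi>
  proof -
    note \<psi> = test_functionD[OF that]
    note \<psi>' = smooth_deriv(2)[OF \<psi>(1)]
    have "integrable unit_interval (\<lambda>x. deriv (deriv \<psi>) x *\<^sub>R F x)"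
      by (intro integrable_scaleR_continuous integrable_continuous_unit_interval cF smooth_continuous smooth_deriv \<psi>)
    from lebesgue_integral_unit_interval[OF this] have 1: "(\<integral>x. deriv (deriv \<psi>) x *\<^sub>R F x \<partial>unit_interval) = - integral {0..1} (\<lambda>x. deriv \<psi> x *\<^sub>R F' x)"
      using integral_by_parts_vanishing[OF \<psi>' \<psi>(4,5) d c'] by simp
    have 2: "(\<integral>x. \<psi> x *\<^sub>R g x \<partial>unit_interval) = - integral {0..1} (\<lambda>x. deriv \<psi> x *\<^sub>R G x)"
      using integral_by_parts_primitive[OF \<psi>(1,3) ig]
        lebesgue_integral_unit_interval[OF integrable_scaleR_continuous[OF ig smooth_continuous[OF \<psi>(1)]]]
      by (simp add: G_def)
    have a: "(\<lambda>x. deriv (deriv \<psi>) x *\<^sub>R f x) =\<^sub>a\<^sub>e (\<lambda>x. deriv (deriv \<psi>) x *\<^sub>R F x)"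
      using ae by (auto simp: ae_eq_def)
    have m: "(\<lambda>x. deriv (deriv \<psi>) x *\<^sub>R F x) \<in> borel_measurable unit_interval"
      by (intro borel_measurable_continuous_unit_interval continuous_intros cF smooth_continuous smooth_deriv \<psi>)
    have 3: "(\<integral>x. deriv (deriv \<psi>) x *\<^sub>R f x \<partial>unit_interval) = (\<integral>x. deriv (deriv \<psi>) x *\<^sub>R F x \<partial>unit_interval)"
      by (rule integral_cong_AE[OF borel_measurable_ae_eq[OF a m] m a[unfolded ae_eq_def]])
    have "integral {0..1} (\<lambda>x. deriv \<psi> x *\<^sub>R (F' x - G x))
        = integral {0..1} (\<lambda>x. deriv \<psi> x *\<^sub>R F' x) - integral {0..1} (\<lambda>x. deriv \<psi> x *\<^sub>R G x)"
      unfolding scaleR_diff_right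
      by (intro Henstock_Kurzweil_Integration.integral_diff integrable_continuous_real continuous_intros
          cG c' smooth_continuous \<psi>')
    then show ?thesis
      using 1 2 3 by (auto simp: numeral_2_eq_2)
  qed
  have "has_weak_deriv 2 f g \<longleftrightarrow>
      (\<forall>\<psi>. test_function \<psi> \<longrightarrow> integral {0..1} (\<lambda>x. deriv \<psi> x *\<^sub>R (F' x - G x)) = 0)"
    unfolding has_weak_deriv_def using key by blast
  also have "\<dots> \<longleftrightarrow> (\<forall>x\<in>{0..1}. F' x = F' 0 + G x)"
  proof (intro iffI ballI allI impI)
    fix x :: real assume "\<forall>\<psi>. test_function \<psi> \<longrightarrow> integral {0..1} (\<lambda>x. deriv \<psi> x *\<^sub>R (F' x - G x)) = 0"
      and x: "x \<in> {0..1}"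
    then have "F' x - G x = F' 0 - G 0"
      by (intro du_Bois_Reymond[of "\<lambda>x. F' x - G x"] continuous_intros c' cG) auto
    then show "F' x = F' 0 + G x" by (simp add: G_def algebra_simps)
  next
    fix \<psi> assume *: "\<forall>x\<in>{0..1}. F' x = F' 0 + G x" and "test_function \<psi>"
    note \<psi> = test_functionD[OF this(2)]
    have "integral {0..1} (\<lambda>x. deriv \<psi> x *\<^sub>R (F' x - G x)) = integral {0..1} (\<lambda>x. deriv \<psi> x *\<^sub>R F' 0)"
      using * by (intro Henstock_Kurzweil_Integration.integral_cong) (metis add_diff_cancel_right')
    also have "\<dots> = 0"
      using integral_by_parts_vanishing[OF \<psi>(1-3), of "\<lambda>_. F' 0" "\<lambda>_. 0"] by simp
    finally show "integral {0..1} (\<lambda>x. deriv \<psi> x *\<^sub>R (F' x - G x)) = 0" .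
  qed
  finally show ?thesis by (simp add: G_def)
qed

text \<open>Invertibility of \<open>A\<close> recovers the weak second derivative from
  \<open>u\<close> as \<open>- (B *v u x)\<close>, so the intermediate functions \<open>h\<close>
  and \<open>g\<close> in the definitions disappear.\<close>

lemma matrix_times_D_op_iff:
  fixes A B :: "complex^2^2"
  assumes AB: "A ** B = mat 1" and BA: "B ** A = mat 1"
  shows "(f, u) \<in> matrix_times_op A D_op \<longleftrightarrow> u \<in> L2_space \<and>
    (\<exists>F F'. C1_representative f F F' \<and> F 0 $ 1 = 0 \<and> F 1 $ 1 = 0 \<and> F' 0 $ 2 = 0 \<and> F' 1 $ 2 = 0 \<and>
      (\<forall>x\<in>{0..1}. A *v F' x = A *v F' 0 - integral {0..x} u))"
    (is "?l \<longleftrightarrow> ?r")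
proof
  assume ?l
  then obtain h g F F' where u: "u \<in> L2_space" "u =\<^sub>a\<^sub>e (\<lambda>x. A *v h x)"
    and g: "g \<in> L2_space" "has_weak_deriv 2 f g" "h =\<^sub>a\<^sub>e (\<lambda>x. - g x)"
    and F: "C1_representative f F F'" "F 0 $ 1 = 0" "F 1 $ 1 = 0" "F' 0 $ 2 = 0" "F' 1 $ 2 = 0"
    by (auto simp: matrix_times_op_def D_op_def Dom_D_def)
  have ae: "AE x in unit_interval. u x = - (A *v g x)"
    using u(2) g(3) unfolding ae_eq_def by eventually_elim (simp add: vec.neg)
  have "A *v F' x = A *v F' 0 - integral {0..x} u" if x: "x \<in> {0..1}" for x
  proof -
    have "integral {0..x} u = integral {0..x} (\<lambda>t. - (A *v g t))"
      using x by (intro integral_cong_AE_unit_interval[OF ae]) auto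
    also have "\<dots> = - integral {0..x} (\<lambda>t. A *v g t)" by simp
    also have "integral {0..x} (\<lambda>t. A *v g t) = A *v integral {0..x} g"
      using integral_linear[OF integrable_on_unit_subinterval[OF integrable_L2[OF g(1)]]
          matrix_vector_mul_bounded_linear, of 0 x A] x
      by (simp add: o_def)
    also have "integral {0..x} g = F' x - F' 0"
      using has_weak_deriv_2_iff[OF F(1) g(1), THEN iffD1, OF g(2), rule_format, OF x]
      by (metis add_diff_cancel_left')
    finally show ?thesis by (simp add: matrix_vector_mult_diff_distrib)
  qed
  then show ?r using u F by blast
next
  assume ?r
  then obtain F F' where u: "u \<in> L2_space"
    and F: "C1_representative f F F'" "F 0 $ 1 = 0" "F 1 $ 1 = 0" "F' 0 $ 2 = 0" "F' 1 $ 2 = 0"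
    and eq: "\<And>x. x \<in> {0..1} \<Longrightarrow> A *v F' x = A *v F' 0 - integral {0..x} u"
    by blast
  define g where "g x = - (B *v u x)" for x
  have bl: "bounded_linear (\<lambda>v. - (B *v v))"
    by (intro bounded_linear_minus matrix_vector_mul_bounded_linear)
  have g: "g \<in> L2_space" unfolding g_def by (rule L2_space_linear[OF u bl])
  have "F' x = F' 0 + integral {0..x} g" if x: "x \<in> {0..1}" for x
  proof -
    have "integral {0..x} g = - (B *v integral {0..x} u)"
      using integral_linear[OF integrable_on_unit_subinterval[OF integrable_L2[OF u]] bl, of 0 x] x
      by (simp add: o_def g_def[abs_def])
    moreover have "B *v (A *v F' x) = B *v (A *v F' 0 - integral {0..x} u)"
      using eq[OF x] by simp
    ultimately show ?thesis
      using BA by (simp add: matrix_vector_mul_assoc matrix_vector_mult_diff_distrib)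
  qed
  then have w: "has_weak_deriv 2 f g" using has_weak_deriv_2_iff[OF F(1) g] by blast
  have "continuous_on {0..1} F"
    using F(1) unfolding C1_representative_def by (intro continuous_on_vector_derivative) auto
  then have "f \<in> L2_space"
    using F(1) unfolding C1_representative_def by (intro L2_space_cong[of f F] L2_space_continuous) auto
  then have dom: "f \<in> Dom_D" using w g F unfolding Dom_D_def W22_def by blast
  have "(\<lambda>x. B *v u x) \<in> L2_space"
    by (rule L2_space_linear[OF u matrix_vector_mul_bounded_linear])
  then have "(f, \<lambda>x. B *v u x) \<in> D_op"
    unfolding D_op_def using dom g w by (auto simp: ae_eq_def g_def intro!: bexI[of _ g])
  moreover have "u =\<^sub>a\<^sub>e (\<lambda>x. A *v (B *v u x))"
    using AB by (simp add: ae_eq_def matrix_vector_mul_assoc)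
  ultimately show ?l unfolding matrix_times_op_def using u by blast
qed

section \<open>The inhomogeneous oscillator equation\<close>

text \<open>Integrated form of y'' + k^2 y = - h; for merely integrable \<open>h\<close> the second
  derivative need not exist at every point.\<close>

definition oscillator_solution ::
  "complex \<Rightarrow> (real \<Rightarrow> complex) \<Rightarrow> (real \<Rightarrow> complex) \<Rightarrow> (real \<Rightarrow> complex) \<Rightarrow> bool" where
  "oscillator_solution k h y y' \<longleftrightarrow>
     (\<forall>x\<in>{0..1}. (y has_vector_derivative y' x) (at x within {0..1})) \<and>
     continuous_on {0..1} y' \<and>
     (\<forall>x\<in>{0..1}. y' x = y' 0 - integral {0..x} (\<lambda>t. h t + k\<^sup>2 * y t))"

lemma oscillator_solutionD:
  assumes "oscillator_solution k h y y'"
  shows "x \<in> {0..1} \<Longrightarrow> (y has_vector_derivative y' x) (at x within {0..1})"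
    and "continuous_on {0..1} y'"
    and "x \<in> {0..1} \<Longrightarrow> y' x = y' 0 - integral {0..x} (\<lambda>t. h t + k\<^sup>2 * y t)"
  using assms unfolding oscillator_solution_def by blast+

lemma
  fixes k :: complex
  shows has_vector_derivative_cos_scaled [derivative_intros]:
      "((\<lambda>x. cos (k * of_real x)) has_vector_derivative - (k * sin (k * of_real x))) (at x within S)"
    and has_vector_derivative_sin_scaled [derivative_intros]:
      "((\<lambda>x. sin (k * of_real x)) has_vector_derivative k * cos (k * of_real x)) (at x within S)"
proof -
  have "((\<lambda>z. cos (k * z)) has_field_derivative - (k * sin (k * of_real x))) (at (of_real x))"
    "((\<lambda>z. sin (k * z)) has_field_derivative k * cos (k * of_real x)) (at (of_real x))"
    by (auto intro!: derivative_eq_intros)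
  then show "((\<lambda>x. cos (k * of_real x)) has_vector_derivative - (k * sin (k * of_real x))) (at x within S)"
    "((\<lambda>x. sin (k * of_real x)) has_vector_derivative k * cos (k * of_real x)) (at x within S)"
    using has_vector_derivative_real_field has_vector_derivative_at_within by blast+
qed

text \<open>The Wronskians of \<open>y\<close> with the sine and the cosine are constant: y cos - y'
  sin / k and k y sin + y' cos keep their values at 0. Solving these two equations with sin^2 +
  cos^2 = 1 gives \<open>y\<close> and \<open>y'\<close>.\<close>

lemma oscillator_homogeneous:
  assumes k: "k \<noteq> 0" and y: "oscillator_solution k (\<lambda>_. 0) y y'" and x: "x \<in> {0..1}"
  shows "y x = y 0 * cos (k * of_real x) + y' 0 * sin (k * of_real x) / k"
    and "y' x = y' 0 * cos (k * of_real x) - y 0 * k * sin (k * of_real x)"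
proof -
  have d: "(y has_vector_derivative y' x) (at x within {0..1})" if "x \<in> {0..1}" for x
    using oscillator_solutionD(1)[OF y that] .
  have c: "continuous_on {0..1} y" using d by (rule continuous_on_vector_derivative)
  have d': "(y' has_vector_derivative - (k\<^sup>2 * y x)) (at x within {0..1})" if x: "x \<in> {0..1}" for x
  proof -
    have "((\<lambda>x. y' 0 - integral {0..x} (\<lambda>t. k\<^sup>2 * y t)) has_vector_derivative 0 - k\<^sup>2 * y x) (at x within {0..1})"
      using x by (intro has_vector_derivative_diff has_vector_derivative_const
          integral_has_vector_derivative continuous_intros c)
    then have "((\<lambda>x. y' 0 - integral {0..x} (\<lambda>t. k\<^sup>2 * y t)) has_vector_derivative - (k\<^sup>2 * y x)) (at x within {0..1})"
      by simp
    moreover have eq: "y' t = y' 0 - integral {0..t} (\<lambda>t. k\<^sup>2 * y t)" if "t \<in> {0..1}" for t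
      using oscillator_solutionD(3)[OF y that] by (simp only: add_0)
    ultimately show ?thesis
      by (intro has_vector_derivative_transform[OF x eq])
  qed
  let ?c = "\<lambda>x. cos (k * complex_of_real x)" and ?s = "\<lambda>x. sin (k * complex_of_real x)"
  have "((\<lambda>x. y x * ?c x - 1 / k * (y' x * ?s x)) has_vector_derivative 0) (at x within {0..1})" if "x \<in> {0..1}" for x
    by (rule has_vector_derivative_eq_rhs, (rule derivative_intros d[OF that] d'[OF that])+)
      (use k in \<open>simp add: power2_eq_square field_simps\<close>)
  then obtain C1 where C1: "\<And>x. x \<in> {0..1} \<Longrightarrow> y x * ?c x - 1 / k * (y' x * ?s x) = C1"
    using has_vector_derivative_zero_constant[of "{0..1::real}"] by (metis (no_types, lifting) convex_real_interval(5))
  have "((\<lambda>x. k * y x * ?s x + y' x * ?c x) has_vector_derivative 0) (at x within {0..1})" if "x \<in> {0..1}" for x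
    by (rule has_vector_derivative_eq_rhs, (rule derivative_intros d[OF that] d'[OF that])+)
      (use k in \<open>simp add: power2_eq_square field_simps\<close>)
  then obtain C2 where C2: "\<And>x. x \<in> {0..1} \<Longrightarrow> k * y x * ?s x + y' x * ?c x = C2"
    using has_vector_derivative_zero_constant[of "{0..1::real}"] by (metis (no_types, lifting) convex_real_interval(5))
  have e1: "y x * ?c x - 1 / k * (y' x * ?s x) = y 0" using C1[OF x] C1[of 0] by simp
  have e2: "k * y x * ?s x + y' x * ?c x = y' 0" using C2[OF x] C2[of 0] by simp
  have one: "?c x * ?c x = 1 - ?s x * ?s x"
    using sin_cos_squared_add[of "k * of_real x"] by (simp add: power2_eq_square algebra_simps)
  have "y 0 * ?c x + y' 0 * ?s x / k = y x * (?c x * ?c x) + y x * (?s x * ?s x)"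
    unfolding e1[symmetric] e2[symmetric] using k by (simp add: field_simps)
  then show "y x = y 0 * ?c x + y' 0 * ?s x / k" unfolding one by (simp add: algebra_simps)
  have "y' 0 * ?c x - y 0 * k * ?s x = y' x * (?c x * ?c x) + y' x * (?s x * ?s x)"
    unfolding e1[symmetric] e2[symmetric] using k by (simp add: field_simps)
  then show "y' x = y' 0 * ?c x - y 0 * k * ?s x" unfolding one by (simp add: algebra_simps)
qed

text \<open>The offsets \<open>r\<close>, \<open>r'\<close> of the values at 1 are independent of the initial values \<open>\<alpha>\<close>, \<open>\<beta>\<close>, so
  that boundary conditions become linear equations for \<open>\<alpha>\<close>, \<open>\<beta>\<close>.\<close>

definition controls_solutions :: "complex \<Rightarrow> real \<Rightarrow> bool" where
  "controls_solutions k K \<longleftrightarrow> K \<ge> 0 \<and>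
    (\<forall>h p. h integrable_on {0..1} \<longrightarrow> (\<forall>x\<in>{0..1}. norm (integral {0..x} h) \<le> p) \<longrightarrow>
      (\<exists>r r'. norm r \<le> K * p \<and> norm r' \<le> K * p \<and>
        (\<forall>\<alpha> \<beta>. \<exists>y y'. oscillator_solution k h y y' \<and> y 0 = \<alpha> \<and> y' 0 = \<beta> \<and>
          y 1 = \<alpha> * cos k + \<beta> * sin k / k + r \<and>
          y' 1 = \<beta> * cos k - \<alpha> * k * sin k + r' \<and>
          (\<forall>x\<in>{0..1}. norm (y x) \<le> K * (norm \<alpha> + norm \<beta> + p)))))"

lemma controls_solutionsE:
  assumes "controls_solutions k K" "h integrable_on {0..1}"
    "\<And>x. x \<in> {0..1} \<Longrightarrow> norm (integral {0..x} h) \<le> p"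
  obtains r r' where "norm r \<le> K * p" "norm r' \<le> K * p"
    "\<forall>\<alpha> \<beta>. \<exists>y y'. oscillator_solution k h y y' \<and> y 0 = \<alpha> \<and> y' 0 = \<beta> \<and>
        y 1 = \<alpha> * cos k + \<beta> * sin k / k + r \<and>
        y' 1 = \<beta> * cos k - \<alpha> * k * sin k + r' \<and>
        (\<forall>x\<in>{0..1}. norm (y x) \<le> K * (norm \<alpha> + norm \<beta> + p))"
proof -
  have "\<exists>r r'. norm r \<le> K * p \<and> norm r' \<le> K * p \<and>
        (\<forall>\<alpha> \<beta>. \<exists>y y'. oscillator_solution k h y y' \<and> y 0 = \<alpha> \<and> y' 0 = \<beta> \<and>
          y 1 = \<alpha> * cos k + \<beta> * sin k / k + r \<and>
          y' 1 = \<beta> * cos k - \<alpha> * k * sin k + r' \<and>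
          (\<forall>x\<in>{0..1}. norm (y x) \<le> K * (norm \<alpha> + norm \<beta> + p)))"
    using assms unfolding controls_solutions_def by blast
  then show thesis using that by blast
qed

text \<open>Put y = P + q, where P'' = - h. Then q'' + k^2 q = - k^2 P has a continuous right-hand
  side and is solved classically by variation of constants. Only the primitive of \<open>h\<close>
  enters, which is why a bound \<open>p\<close> on that primitive suffices.\<close>

lemma oscillator_solve:
  fixes k :: complex
  assumes k: "k \<noteq> 0"
  obtains K where "controls_solutions k K"
proof -
  let ?c = "\<lambda>x. cos (k * complex_of_real x)" and ?s = "\<lambda>x. sin (k * complex_of_real x)"
  have cc: "continuous_on {0..1} ?c" "continuous_on {0..1} ?s"
    by (intro continuous_intros)+
  obtain M1 where M1: "\<And>x. x \<in> {0..1} \<Longrightarrow> norm (?c x) \<le> M1"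
    using continuous_on_unit_interval_bounded[OF cc(1)] by blast
  obtain M2 where M2: "\<And>x. x \<in> {0..1} \<Longrightarrow> norm (?s x) \<le> M2"
    using continuous_on_unit_interval_bounded[OF cc(2)] by blast
  define M where "M = max 0 (max M1 M2)"
  have M: "M \<ge> 0" "\<And>x. x \<in> {0..1} \<Longrightarrow> norm (?c x) \<le> M" "\<And>x. x \<in> {0..1} \<Longrightarrow> norm (?s x) \<le> M"
    using M1 M2 by (force simp: M_def)+
  \<comment> \<open>The sum of all coefficients that occur in the estimates below.\<close>
  define K where "K = M + M / norm k + 1 + 2 * norm k * (M * M) + 2 * (norm k * norm k) * (M * M)"
  have K: "M \<le> K" "M / norm k \<le> K" "1 + 2 * norm k * (M * M) \<le> K"
      "1 + 2 * (norm k * norm k) * (M * M) \<le> K"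
    using M(1) by (auto simp: K_def add_nonneg_nonneg)
  have main: "\<exists>r r'. norm r \<le> K * p \<and> norm r' \<le> K * p \<and>
        (\<forall>\<alpha> \<beta>. \<exists>y y'. oscillator_solution k h y y' \<and> y 0 = \<alpha> \<and> y' 0 = \<beta> \<and>
          y 1 = \<alpha> * cos k + \<beta> * sin k / k + r \<and>
          y' 1 = \<beta> * cos k - \<alpha> * k * sin k + r' \<and>
          (\<forall>x\<in>{0..1}. norm (y x) \<le> K * (norm \<alpha> + norm \<beta> + p)))"
    if h: "h integrable_on {0..1}" and hp: "\<And>x. x \<in> {0..1} \<Longrightarrow> norm (integral {0..x} h) \<le> p"
    for h :: "real \<Rightarrow> complex" and p :: real
  proof -
    have p: "p \<ge> 0" using hp[of 0] by simp
    define H where "H x = integral {0..x} h" for x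
    have cH: "continuous_on {0..1} H"
      unfolding H_def using h by (rule indefinite_integral_continuous_1)
    define P where "P x = - integral {0..x} H" for x
    have dP: "(P has_vector_derivative - H x) (at x within {0..1})" if "x \<in> {0..1}" for x
      unfolding P_def[abs_def] using that cH
      by (intro has_vector_derivative_minus integral_has_vector_derivative)
    have cP: "continuous_on {0..1} P" using dP by (rule continuous_on_vector_derivative)
    have intb: "norm (integral {0..x} f) \<le> b"
      if x: "x \<in> {0..1}" and f: "continuous_on {0..1} f" "\<And>t. t \<in> {0..1} \<Longrightarrow> norm (f t) \<le> b" "b \<ge> 0"
      for f :: "real \<Rightarrow> complex" and x b
    proof -
      have "norm (integral {0..x} f) \<le> b * (x - 0)"
        using x f continuous_on_subset[OF f(1), of "{0..x}"] by (intro integral_bound) auto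
      also have "\<dots> \<le> b" using x f(3) by (simp add: mult_left_le)
      finally show ?thesis .
    qed
    have bP: "norm (P x) \<le> p" if "x \<in> {0..1}" for x
      using intb[OF that cH, of p] hp p by (simp add: H_def P_def)
    \<comment> \<open>By the addition theorem, - k sin(kx) Ic + k cos(kx) Is is - k times the
      integral of sin(k(x - t)) P(t) over [0, x], the variation-of-constants solution for the
      forcing - k^2 P.\<close>
    define Ic where "Ic x = integral {0..x} (\<lambda>t. ?c t * P t)" for x
    define Is where "Is x = integral {0..x} (\<lambda>t. ?s t * P t)" for x
    have bI: "norm (Ic x) \<le> M * p" "norm (Is x) \<le> M * p" if "x \<in> {0..1}" for x
      unfolding Ic_def Is_def using that cc cP M bP p
      by (auto intro!: intb continuous_intros mult_mono simp: norm_mult)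
    have dI: "(Ic has_vector_derivative ?c x * P x) (at x within {0..1})"
      "(Is has_vector_derivative ?s x * P x) (at x within {0..1})" if "x \<in> {0..1}" for x
      unfolding Ic_def[abs_def] Is_def[abs_def] using that
      by (auto intro!: integral_has_vector_derivative continuous_intros cP)
    have prods: "norm (k * ?s x * Ic x) \<le> norm k * (M * M) * p"
      "norm (k * ?c x * Is x) \<le> norm k * (M * M) * p"
      "norm (k * k * ?c x * Ic x) \<le> norm k * norm k * (M * M) * p"
      "norm (k * k * ?s x * Is x) \<le> norm k * norm k * (M * M) * p" if "x \<in> {0..1}" for x
    proof -
      have "norm (?s x) * norm (Ic x) \<le> M * (M * p)" "norm (?c x) * norm (Is x) \<le> M * (M * p)"
        "norm (?c x) * norm (Ic x) \<le> M * (M * p)" "norm (?s x) * norm (Is x) \<le> M * (M * p)"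
        using M bI that by (auto intro!: mult_mono)
      then show "norm (k * ?s x * Ic x) \<le> norm k * (M * M) * p"
        "norm (k * ?c x * Is x) \<le> norm k * (M * M) * p"
        "norm (k * k * ?c x * Ic x) \<le> norm k * norm k * (M * M) * p"
        "norm (k * k * ?s x * Is x) \<le> norm k * norm k * (M * M) * p"
        by (auto simp: norm_mult mult.assoc intro!: mult_left_mono)
    qed
    have tri3: "norm (u + v - w) \<le> norm u + norm v + norm w" for u v w :: complex
      using norm_triangle_ineq4[of "u + v" w] norm_triangle_ineq[of u v] by linarith
    have inhom: "norm (P x - k * ?s x * Ic x + k * ?c x * Is x) \<le> (1 + 2 * norm k * (M * M)) * p"
      if x: "x \<in> {0..1}" for x
      using tri3[of "P x" "k * ?c x * Is x" "k * ?s x * Ic x"] prods[OF x] bP[OF x]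
      by (simp add: algebra_simps)
    define r where "r = P 1 - k * ?s 1 * Ic 1 + k * ?c 1 * Is 1"
    \<comment> \<open>The double negation gives the bracket the shape \<open>u + v - w\<close> of
      \<open>tri3\<close>.\<close>
    define r' where "r' = - (H 1 + k * k * ?c 1 * Ic 1 - (- (k * k * ?s 1 * Is 1)))"
    have "norm r \<le> (1 + 2 * norm k * (M * M)) * p"
      unfolding r_def using inhom[of 1] by simp
    also have "\<dots> \<le> K * p" using K p by (intro mult_right_mono)
    finally have b1: "norm r \<le> K * p" .
    have "norm r' \<le> (1 + 2 * (norm k * norm k) * (M * M)) * p"
      using tri3[of "H 1" "k * k * ?c 1 * Ic 1" "- (k * k * ?s 1 * Is 1)"] prods(3,4)[of 1] hp[of 1]
      unfolding r'_def norm_minus_cancel H_def by (simp add: algebra_simps)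
    also have "\<dots> \<le> K * p" using K p by (intro mult_right_mono)
    finally have b2: "norm r' \<le> K * p" .
    have "\<exists>y y'. oscillator_solution k h y y' \<and> y 0 = \<alpha> \<and> y' 0 = \<beta> \<and>
          y 1 = \<alpha> * cos k + \<beta> * sin k / k + r \<and>
          y' 1 = \<beta> * cos k - \<alpha> * k * sin k + r' \<and>
          (\<forall>x\<in>{0..1}. norm (y x) \<le> K * (norm \<alpha> + norm \<beta> + p))" for \<alpha> \<beta>
    proof -
      \<comment> \<open>Naming the quotient makes the identity \<open>trig\<close>
        polynomial.\<close>
      define b where "b = \<beta> / k"
      have kb: "k * b = \<beta>" using k by (simp add: b_def)
      define q where "q x = \<alpha> * ?c x + b * ?s x - k * ?s x * Ic x + k * ?c x * Is x" for x
      define q' where "q' x = \<beta> * ?c x - \<alpha> * k * ?s x - k * k * ?c x * Ic x - k * k * ?s x * Is x" for x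
      have dq: "(q has_vector_derivative q' x) (at x within {0..1})" if "x \<in> {0..1}" for x
        unfolding q_def[abs_def]
        by (rule has_vector_derivative_eq_rhs, (rule derivative_intros dI[OF that])+)
          (simp add: q'_def kb[symmetric] algebra_simps)
      have dq': "(q' has_vector_derivative - (k\<^sup>2 * (P x + q x))) (at x within {0..1})" if "x \<in> {0..1}" for x
      proof -
        \<comment> \<open>The left side is the derivative of \<open>q'\<close> exactly as the
          differentiation rules deliver it.\<close>
        have trig: "\<beta>' * - (k * s) + 0 * c - (a * (k * c) + 0 * s) - (k * k * c * (c * p) + (k * k * - (k * s) + 0 * c) * u)
            - (k * k * s * (s * p) + (k * k * (k * c) + 0 * s) * v) = - (k\<^sup>2 * (p + (\<alpha> * c + b * s - k * s * u + k * c * v)))"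
          if "c\<^sup>2 + s\<^sup>2 = 1" "\<beta>' = k * b" "a = \<alpha> * k" for c s a u v p \<beta>' :: complex
          using that by algebra
        show ?thesis
          unfolding q'_def[abs_def]
          by (rule has_vector_derivative_eq_rhs, (rule derivative_intros dI[OF that])+)
            (use trig[of "?c x" "?s x" \<beta> "\<alpha> * k" "P x" "Ic x" "Is x"]
               kb sin_cos_squared_add2[of "k * of_real x"] in \<open>simp add: q_def\<close>)
      qed
      define y where "y x = P x + q x" for x
      define y' where "y' x = - H x + q' x" for x
      have dy: "(y has_vector_derivative y' x) (at x within {0..1})" if "x \<in> {0..1}" for x
        unfolding y_def[abs_def] y'_def by (intro has_vector_derivative_add dP dq that)
      have cy: "continuous_on {0..1} y" using dy by (rule continuous_on_vector_derivative)
      have cq': "continuous_on {0..1} q'" using dq' by (rule continuous_on_vector_derivative)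
      have init: "y 0 = \<alpha>" "y' 0 = \<beta>"
        by (simp_all add: y_def y'_def P_def H_def q_def q'_def Ic_def Is_def)
      have "y' x = y' 0 - integral {0..x} (\<lambda>t. h t + k\<^sup>2 * y t)" if x: "x \<in> {0..1}" for x
      proof -
        have "((\<lambda>x. - (k\<^sup>2 * y x)) has_integral (q' x - q' 0)) {0..x}"
          unfolding y_def
        proof (rule fundamental_theorem_of_calculus)
          fix t assume "t \<in> {0..x}"
          then have "t \<in> {0..1}" using x by auto
          then show "(q' has_vector_derivative - (k\<^sup>2 * (P t + q t))) (at t within {0..x})"
            using x by (intro has_vector_derivative_within_subset[OF dq']) auto
        qed (use x in simp)
        from integral_unique[OF has_integral_neg[OF this]]
        have "integral {0..x} (\<lambda>t. k\<^sup>2 * y t) = q' 0 - q' x" by simp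
        moreover have "integral {0..x} (\<lambda>t. h t + k\<^sup>2 * y t) = H x + integral {0..x} (\<lambda>t. k\<^sup>2 * y t)"
          unfolding H_def using x
          by (intro Henstock_Kurzweil_Integration.integral_add integrable_continuous_real continuous_intros
              integrable_on_subinterval[OF h] continuous_on_subset[OF cy]) auto
        ultimately show ?thesis by (simp add: y'_def H_def)
      qed
      moreover have "continuous_on {0..1} y'"
        unfolding y'_def[abs_def] by (intro continuous_intros cH cq')
      ultimately have sol: "oscillator_solution k h y y'"
        unfolding oscillator_solution_def using dy by blast
      have b3: "norm (y x) \<le> K * (norm \<alpha> + norm \<beta> + p)" if x: "x \<in> {0..1}" for x
      proof -
        let ?w = "P x - k * ?s x * Ic x + k * ?c x * Is x"
        have "y x = \<alpha> * ?c x + \<beta> * ?s x / k - (- ?w)"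
          by (simp add: y_def q_def b_def)
        then have "norm (y x) \<le> norm (\<alpha> * ?c x) + norm (\<beta> * ?s x / k) + norm ?w"
          using tri3[of "\<alpha> * ?c x" "\<beta> * ?s x / k" "- ?w"] by (simp only: norm_minus_cancel)
        also have "\<dots> \<le> norm \<alpha> * M + norm \<beta> * (M / norm k) + (1 + 2 * norm k * (M * M)) * p"
          using inhom[OF x] M(2,3)[OF x] M(1)
          by (intro add_mono) (auto simp: norm_mult norm_divide intro!: mult_left_mono divide_right_mono)
        also have "\<dots> \<le> norm \<alpha> * K + norm \<beta> * K + K * p"
          using K p by (intro add_mono mult_left_mono mult_right_mono) auto
        finally show ?thesis by (simp add: algebra_simps)
      qed
      have "y 1 = \<alpha> * cos k + \<beta> * sin k / k + r" "y' 1 = \<beta> * cos k - \<alpha> * k * sin k + r'"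
        by (simp_all add: y_def q_def b_def r_def y'_def q'_def r'_def)
      then show ?thesis using sol init b3 by blast
    qed
    then show ?thesis
      using b1 b2 by blast
  qed
  have "0 \<le> K" using K(1) M(1) by simp
  then have "controls_solutions k K"
    unfolding controls_solutions_def by (intro conjI allI impI main) simp_all
  then show thesis by (rule that)
qed

section \<open>Diagonalisation of the operator\<close>

text \<open>For a root \<open>c\<close> of \<open>c\<^sup>2 - (a - d) c + 1\<close>, this functional is a left eigenvector of \<open>A4 a d\<close>
  with eigenvalue \<open>a - c\<close>.\<close>

definition coord :: "complex \<Rightarrow> complex^2 \<Rightarrow> complex" where
  "coord c v = v $ 1 - c * v $ 2"

text \<open>The two numerators show how the boundary conditions look in the new coordinates: \<phi>
  = 0 becomes \<open>c2 * y1 = c1 * y2\<close>, and \<gamma>' = 0 becomes equality of the two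
  derivatives.\<close>

definition uncoord :: "complex \<Rightarrow> complex \<Rightarrow> complex \<Rightarrow> complex \<Rightarrow> complex^2" where
  "uncoord c1 c2 y1 y2 = vector [(c1 * y2 - c2 * y1) / (c1 - c2), (y2 - y1) / (c1 - c2)]"

lemma uncoord_nth:
  "uncoord c1 c2 y1 y2 $ 1 = (c1 * y2 - c2 * y1) / (c1 - c2)"
  "uncoord c1 c2 y1 y2 $ 2 = (y2 - y1) / (c1 - c2)"
  by (simp_all add: uncoord_def)

lemma bounded_linear_coord: "bounded_linear (coord c)"
  unfolding coord_def[abs_def]
  by (intro bounded_linear_sub bounded_linear_vec_nth
      bounded_linear_compose[OF bounded_linear_mult_right bounded_linear_vec_nth])

lemma norm_coord_le: "norm (coord c v) \<le> (1 + norm c) * norm v"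
proof -
  have "norm (coord c v) \<le> norm (v $ 1) + norm (c * v $ 2)"
    unfolding coord_def by (rule norm_triangle_ineq4)
  also have "\<dots> \<le> norm v + norm c * norm v"
    unfolding norm_mult
    by (intro add_mono mult_left_mono Finite_Cartesian_Product.norm_nth_le norm_ge_zero)
  finally show ?thesis by (simp add: algebra_simps)
qed

lemma coord_uncoord:
  assumes "c1 \<noteq> c2"
  shows "coord c1 (uncoord c1 c2 y1 y2) = y1" "coord c2 (uncoord c1 c2 y1 y2) = y2"
proof -
  have e: "(c1 - c2) * inverse (c1 - c2) = 1" using assms by simp
  show "coord c1 (uncoord c1 c2 y1 y2) = y1" "coord c2 (uncoord c1 c2 y1 y2) = y2"
    unfolding coord_def uncoord_nth divide_inverse using e by algebra+
qed

lemma coord_eqD: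
  assumes "c1 \<noteq> c2" "coord c1 v = coord c1 w" "coord c2 v = coord c2 w"
  shows "v = w"
proof -
  have "(c1 - c2) * v $ 2 = (c1 - c2) * w $ 2"
    using assms(2,3) unfolding coord_def by algebra
  then have 2: "v $ 2 = w $ 2" using assms(1) by simp
  then have "v $ 1 = w $ 1" using assms(2) by (simp add: coord_def)
  with 2 show ?thesis by (simp add: vec_eq_iff forall_2)
qed

lemma norm_uncoord_le:
  "norm (uncoord c1 c2 y1 y2) \<le> (1 + norm c1 + norm c2) / norm (c1 - c2) * (norm y1 + norm y2)"
proof -
  have "norm (uncoord c1 c2 y1 y2) \<le> norm (c1 * y2 - c2 * y1) / norm (c1 - c2) + norm (y2 - y1) / norm (c1 - c2)"
    unfolding norm_vec_def using L2_set_le_sum[of UNIV "\<lambda>i. norm (uncoord c1 c2 y1 y2 $ i)"]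
    by (simp add: uncoord_nth sum_2 norm_divide)
  also have "\<dots> = (norm (c1 * y2 - c2 * y1) + norm (y2 - y1)) / norm (c1 - c2)"
    by (simp add: add_divide_distrib)
  also have "\<dots> \<le> ((norm c1 * norm y2 + norm c2 * norm y1) + (norm y2 + norm y1)) / norm (c1 - c2)"
    using norm_triangle_ineq4[of "c1 * y2" "c2 * y1"] norm_triangle_ineq4[of y2 y1]
    by (intro divide_right_mono add_mono) (simp_all add: norm_mult)
  also have "\<dots> \<le> ((1 + norm c1 + norm c2) * (norm y1 + norm y2)) / norm (c1 - c2)"
    by (intro divide_right_mono) (simp_all add: algebra_simps)
  finally show ?thesis by simp
qed

lemma has_vector_derivative_uncoord:
  assumes "(y1 has_vector_derivative y1') (at x within S)" "(y2 has_vector_derivative y2') (at x within S)"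
  shows "((\<lambda>x. uncoord c1 c2 (y1 x) (y2 x)) has_vector_derivative uncoord c1 c2 y1' y2') (at x within S)"
proof -
  have bl: "bounded_linear (\<lambda>p. uncoord c1 c2 (fst p) (snd p))"
    by (intro linear_conv_bounded_linear[THEN iffD1] linearI)
      (simp_all add: vec_eq_iff forall_2 uncoord_def add_divide_distrib diff_divide_distrib algebra_simps scaleR_conv_of_real[where 'a = complex])
  from bounded_linear.has_vector_derivative[OF bl has_vector_derivative_Pair[OF assms]]
  show ?thesis by simp
qed

lemma continuous_on_uncoord:
  assumes "continuous_on S y1" "continuous_on S y2"
  shows "continuous_on S (\<lambda>x. uncoord c1 c2 (y1 x) (y2 x))"
proof -
  have "continuous_on S (\<lambda>x. uncoord c1 c2 (y1 x) (y2 x) $ i)" for i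
    using exhaust_2[of i]
    by (elim disjE; simp only: uncoord_nth divide_inverse; intro continuous_intros assms)
  then have "continuous_on S (\<lambda>x. \<chi> i. uncoord c1 c2 (y1 x) (y2 x) $ i)"
    by (intro continuous_on_vec_lambda)
  then show ?thesis by simp
qed

lemma A4_inverse:
  assumes "a * d \<noteq> -1"
  obtains B where "A4 a d ** B = mat 1" "B ** A4 a d = mat 1"
proof -
  let ?D = "complex_of_real (a * d + 1)"
  have "a * d + 1 \<noteq> 0" using assms by linarith
  then have D: "?D \<noteq> 0" using of_real_eq_0_iff by blast
  define e where "e = inverse ?D"
  have e: "(complex_of_real a * complex_of_real d + 1) * e = 1" using D by (simp add: e_def)
  let ?B = "vector [vector [of_real d * e, e], vector [- e, of_real a * e]] :: complex^2^2"
  show thesis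
    by (rule that[of ?B]; use e in \<open>simp add: vec_eq_iff forall_2 matrix_matrix_mult_def sum_2 A4_def mat_def algebra_simps\<close>)
qed

text \<open>The data belonging to one nonzero \<open>z\<close>. The first two conditions on
  \<open>c1\<close>, \<open>c2\<close> make them the roots of c^2 - (a - d) c + 1, and
  \<open>k1\<close>, \<open>k2\<close> are the frequencies left after dividing \<open>z\<close> by
  the eigenvalues \<open>of_real a - c1\<close> and \<open>of_real a - c2\<close>.\<close>

locale oscillator_pair =
  fixes a d :: real and c1 c2 z k1 k2 :: complex
  assumes det: "a * d \<noteq> -1"
    and c_sum: "c1 + c2 = of_real (a - d)" and c_prod: "c1 * c2 = 1" and c_ne: "c1 \<noteq> c2"
    and k1: "k1 \<noteq> 0" and k2: "k2 \<noteq> 0" and z: "z \<noteq> 0"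
    and z1: "(of_real a - c1) * k1\<^sup>2 = z" and z2: "(of_real a - c2) * k2\<^sup>2 = z"
begin

abbreviation "T \<equiv> matrix_times_op (A4 a d) D_op"

text \<open>Start with y_j(0) = \<open>c\<close>_j \<alpha> and y_j'(0) = \<beta>. In view of
  \<open>c1 * c2 = 1\<close> the conditions at 1 read m \<alpha> + p \<beta> = 0 and q \<alpha> + m
  \<beta> = 0, where m = cos k1 - cos k2 and p, q are the two factors subtracted here. This is the
  determinant m^2 - p q.\<close>

definition char_det :: complex where
  "char_det = (cos k1 - cos k2)\<^sup>2
     - (c2 * sin k1 / k1 - c1 * sin k2 / k2) * (c2 * k2 * sin k2 - c1 * k1 * sin k1)"

lemma eigen_ne: "of_real a - c1 \<noteq> 0" "of_real a - c2 \<noteq> 0"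
  using z z1 z2 by auto

lemma coord_A4:
  "coord c1 (A4 a d *v v) = (of_real a - c1) * coord c1 v"
  "coord c2 (A4 a d *v v) = (of_real a - c2) * coord c2 v"
proof -
  have A: "(A4 a d *v v) $ 1 = of_real a * v $ 1 - v $ 2" "(A4 a d *v v) $ 2 = v $ 1 + of_real d * v $ 2"
    by (simp_all add: A4_def matrix_vector_mult_def sum_2)
  have s: "c1 + c2 = of_real a - of_real d" using c_sum by simp
  show "coord c1 (A4 a d *v v) = (of_real a - c1) * coord c1 v"
    "coord c2 (A4 a d *v v) = (of_real a - c2) * coord c2 v"
    using s c_prod unfolding coord_def A by algebra+
qed

lemma T_iff:
  "(f, u) \<in> T \<longleftrightarrow> u \<in> L2_space \<and>
    (\<exists>F F'. C1_representative f F F' \<and> F 0 $ 1 = 0 \<and> F 1 $ 1 = 0 \<and> F' 0 $ 2 = 0 \<and> F' 1 $ 2 = 0 \<and>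
      (\<forall>x\<in>{0..1}. A4 a d *v F' x = A4 a d *v F' 0 - integral {0..x} u))"
proof -
  obtain B where "A4 a d ** B = mat 1" "B ** A4 a d = mat 1" using A4_inverse[OF det] .
  then show ?thesis by (rule matrix_times_D_op_iff)
qed

text \<open>Under \<open>coord c\<close> the matrix becomes the factor \<open>of_real a - c\<close>,
  which also divides \<open>z\<close> and therefore cancels.\<close>

lemma coord_solution:
  assumes c: "c \<in> {c1, c2}" and lk: "(of_real a - c) * k\<^sup>2 = z"
    and F: "\<And>x. x \<in> {0..1} \<Longrightarrow> (F has_vector_derivative F' x) (at x within {0..1})"
      "continuous_on {0..1} F'"
    and eq: "\<And>x. x \<in> {0..1} \<Longrightarrow> A4 a d *v F' x = A4 a d *v F' 0 - integral {0..x} (\<lambda>t. z *s F t)"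
  shows "oscillator_solution k (\<lambda>_. 0) (\<lambda>x. coord c (F x)) (\<lambda>x. coord c (F' x))"
  unfolding oscillator_solution_def
proof (intro conjI ballI)
  note bl = bounded_linear_coord[of c]
  show "((\<lambda>x. coord c (F x)) has_vector_derivative coord c (F' x)) (at x within {0..1})"
    if "x \<in> {0..1}" for x
    using bounded_linear.has_vector_derivative[OF bl F(1)[OF that]] .
  show "continuous_on {0..1} (\<lambda>x. coord c (F' x))"
    by (rule continuous_on_compose2[OF linear_continuous_on[OF bl] F(2)]) auto
  have cF: "continuous_on {0..1} F" using F(1) by (rule continuous_on_vector_derivative)
  fix x :: real assume x: "x \<in> {0..1}"
  have czF: "continuous_on {0..x} (\<lambda>t. z *s F t)"
    unfolding vector_scalar_mult_def
    using x by (intro continuous_on_vec_lambda continuous_intros continuous_on_component continuous_on_subset[OF cF]) auto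
  have ne: "of_real a - c \<noteq> 0" using eigen_ne c by auto
  have A: "coord c (A4 a d *v v) = (of_real a - c) * coord c v" for v using coord_A4 c by auto
  have "(of_real a - c) * coord c (F' x) = coord c (A4 a d *v F' 0 - integral {0..x} (\<lambda>t. z *s F t))"
    using A[of "F' x"] eq[OF x] by simp
  also have "\<dots> = (of_real a - c) * coord c (F' 0) - coord c (integral {0..x} (\<lambda>t. z *s F t))"
    unfolding A[symmetric] by (rule linear_diff[OF bounded_linear.linear[OF bl]])
  also have "coord c (integral {0..x} (\<lambda>t. z *s F t)) = integral {0..x} (\<lambda>t. coord c (z *s F t))"
    using integral_linear[OF integrable_continuous_real[OF czF] bl] by (simp add: o_def)
  also have "\<dots> = integral {0..x} (\<lambda>t. (of_real a - c) * (k\<^sup>2 * coord c (F t)))"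
    unfolding lk[symmetric] by (simp add: coord_def algebra_simps)
  also have "\<dots> = (of_real a - c) * integral {0..x} (\<lambda>t. k\<^sup>2 * coord c (F t))"
    by (rule integral_mult_right)
  finally have "(of_real a - c) * coord c (F' x)
      = (of_real a - c) * (coord c (F' 0) - integral {0..x} (\<lambda>t. k\<^sup>2 * coord c (F t)))"
    by (simp add: algebra_simps)
  then show "coord c (F' x) = coord c (F' 0) - integral {0..x} (\<lambda>t. 0 + k\<^sup>2 * coord c (F t))"
    using ne by simp
qed

text \<open>The converse passage, with a right-hand side. The vector equation follows from its two
  coordinates because these determine a vector; the second component is chosen so that subtracting
  \<open>z *s f x\<close> leaves \<open>h x\<close>.\<close>

lemma uncoord_solution:
  assumes h: "h \<in> L2_space"
    and y1: "oscillator_solution k1 (\<lambda>x. coord c1 (h x) / (of_real a - c1)) y1 y1'"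
    and y2: "oscillator_solution k2 (\<lambda>x. coord c2 (h x) / (of_real a - c2)) y2 y2'"
    and bc: "c2 * y1 0 = c1 * y2 0" "c2 * y1 1 = c1 * y2 1" "y1' 0 = y2' 0" "y1' 1 = y2' 1"
  defines "f \<equiv> (\<lambda>x. uncoord c1 c2 (y1 x) (y2 x))"
  shows "(f, \<lambda>x. h x + z *s f x) \<in> T" "continuous_on {0..1} f"
proof -
  define F' where "F' x = uncoord c1 c2 (y1' x) (y2' x)" for x
  have d: "(f has_vector_derivative F' x) (at x within {0..1})" if "x \<in> {0..1}" for x
    unfolding f_def F'_def using oscillator_solutionD(1)[OF y1 that] oscillator_solutionD(1)[OF y2 that]
    by (rule has_vector_derivative_uncoord)
  show cf: "continuous_on {0..1} f" using d by (rule continuous_on_vector_derivative)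
  have rep: "C1_representative f f F'"
    unfolding C1_representative_def using d oscillator_solutionD(2)[OF y1] oscillator_solutionD(2)[OF y2]
    by (auto simp: ae_eq_def F'_def intro!: continuous_on_uncoord)
  define u where "u x = h x + z *s f x" for x
  have bz: "bounded_linear ((*s) z :: complex^2 \<Rightarrow> complex^2)"
    by (intro linear_conv_bounded_linear[THEN iffD1] linearI)
      (simp_all add: vec_eq_iff forall_2 algebra_simps scaleR_conv_of_real[where 'a = complex])
  have u: "u \<in> L2_space"
    unfolding u_def by (intro L2_space_add h L2_space_linear[OF _ bz] L2_space_continuous cf)
  have eq1: "coord c (A4 a d *v F' x) = coord c (A4 a d *v F' 0 - integral {0..x} u)"
    if x: "x \<in> {0..1}" and c: "c \<in> {c1, c2}" and lk: "(of_real a - c) * k\<^sup>2 = z"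
      and y: "oscillator_solution k (\<lambda>x. coord c (h x) / (of_real a - c)) y y'"
      and cy: "\<And>x. coord c (f x) = y x" and cy': "\<And>x. coord c (F' x) = y' x" for c k y y' x
  proof -
    note bl = bounded_linear_coord[of c]
    have ne: "of_real a - c \<noteq> 0" using eigen_ne c by auto
    have A: "coord c (A4 a d *v v) = (of_real a - c) * coord c v" for v using coord_A4 c by auto
    have "coord c (integral {0..x} u) = integral {0..x} (\<lambda>t. coord c (u t))"
      using integral_linear[OF integrable_on_unit_subinterval[OF integrable_L2[OF u]] bl, of 0 x] x
      by (simp add: o_def)
    also have "\<dots> = integral {0..x} (\<lambda>t. (of_real a - c) * (coord c (h t) / (of_real a - c) + k\<^sup>2 * y t))"
    proof (intro Henstock_Kurzweil_Integration.integral_cong)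
      fix t
      have "coord c (u t) = coord c (h t) + z * coord c (f t)" by (simp add: u_def coord_def algebra_simps)
      also have "\<dots> = (of_real a - c) * (coord c (h t) / (of_real a - c) + k\<^sup>2 * y t)"
        unfolding lk[symmetric] cy using ne by (simp add: distrib_left)
      finally show "coord c (u t) = \<dots>" .
    qed
    also have "\<dots> = (of_real a - c) * integral {0..x} (\<lambda>t. coord c (h t) / (of_real a - c) + k\<^sup>2 * y t)"
      by (rule integral_mult_right)
    also have "integral {0..x} (\<lambda>t. coord c (h t) / (of_real a - c) + k\<^sup>2 * y t) = y' 0 - y' x"
      using oscillator_solutionD(3)[OF y x] by (simp only: diff_diff_eq2 add_diff_cancel_left')
    finally have "coord c (integral {0..x} u) = (of_real a - c) * (y' 0 - y' x)" .
    then show ?thesis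
      unfolding linear_diff[OF bounded_linear.linear[OF bl]] A cy' by (simp add: algebra_simps)
  qed
  have "A4 a d *v F' x = A4 a d *v F' 0 - integral {0..x} u" if x: "x \<in> {0..1}" for x
    using eq1[OF x _ z1 y1] eq1[OF x _ z2 y2] coord_uncoord[OF c_ne]
    by (intro coord_eqD[OF c_ne]) (auto simp: f_def F'_def)
  moreover have "f 0 $ 1 = 0" "f 1 $ 1 = 0" "F' 0 $ 2 = 0" "F' 1 $ 2 = 0"
    using bc by (simp_all add: f_def F'_def uncoord_def)
  ultimately have "(f, u) \<in> T" unfolding T_iff using u rep by blast
  then show "(f, \<lambda>x. h x + z *s f x) \<in> T" by (simp add: u_def[abs_def])
qed

section \<open>Bounded inverse and eigenfunctions\<close>

text \<open>Reduces uniqueness to the eigenvalue equation: the difference of the representatives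
  satisfies it in integrated form with all four boundary conditions.\<close>

lemma T_diff_eigen:
  assumes fu: "(f, u) \<in> T" "(g, v) \<in> T"
    and eq: "(\<lambda>x. u x - z *s f x) =\<^sub>a\<^sub>e (\<lambda>x. v x - z *s g x)"
  shows "\<exists>E E'. (\<lambda>x. f x - g x) =\<^sub>a\<^sub>e E \<and>
    (\<forall>x\<in>{0..1}. (E has_vector_derivative E' x) (at x within {0..1})) \<and> continuous_on {0..1} E' \<and>
    E 0 $ 1 = 0 \<and> E 1 $ 1 = 0 \<and> E' 0 $ 2 = 0 \<and> E' 1 $ 2 = 0 \<and>
    (\<forall>x\<in>{0..1}. A4 a d *v E' x = A4 a d *v E' 0 - integral {0..x} (\<lambda>t. z *s E t))"
proof -
  obtain F F' where F: "C1_representative f F F'" "F 0 $ 1 = 0" "F 1 $ 1 = 0" "F' 0 $ 2 = 0" "F' 1 $ 2 = 0"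
      "\<And>x. x \<in> {0..1} \<Longrightarrow> A4 a d *v F' x = A4 a d *v F' 0 - integral {0..x} u" and u: "u \<in> L2_space"
    using fu(1) unfolding T_iff by blast
  obtain G G' where G: "C1_representative g G G'" "G 0 $ 1 = 0" "G 1 $ 1 = 0" "G' 0 $ 2 = 0" "G' 1 $ 2 = 0"
      "\<And>x. x \<in> {0..1} \<Longrightarrow> A4 a d *v G' x = A4 a d *v G' 0 - integral {0..x} v" and v: "v \<in> L2_space"
    using fu(2) unfolding T_iff by blast
  have fg: "AE x in unit_interval. f x = F x" "AE x in unit_interval. g x = G x"
    using F(1) G(1) by (auto simp: C1_representative_def ae_eq_def)
  have ae: "AE x in unit_interval. u x - v x = z *s (F x - G x)"
    using eq[unfolded ae_eq_def] fg by eventually_elim (simp add: vec_eq_iff algebra_simps)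
  show ?thesis
  proof (rule exI[of _ "\<lambda>x. F x - G x"], rule exI[of _ "\<lambda>x. F' x - G' x"], intro conjI ballI)
    show "(\<lambda>x. f x - g x) =\<^sub>a\<^sub>e (\<lambda>x. F x - G x)"
      unfolding ae_eq_def using fg by eventually_elim simp
    show "((\<lambda>x. F x - G x) has_vector_derivative F' x - G' x) (at x within {0..1})" if "x \<in> {0..1}" for x
      using F(1) G(1) that unfolding C1_representative_def by (intro has_vector_derivative_diff) auto
    show "continuous_on {0..1} (\<lambda>x. F' x - G' x)"
      using F(1) G(1) unfolding C1_representative_def by (intro continuous_on_diff) auto
    show "A4 a d *v (F' x - G' x) = A4 a d *v (F' 0 - G' 0) - integral {0..x} (\<lambda>t. z *s (F t - G t))"
      if x: "x \<in> {0..1}" for x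
    proof -
      have "integral {0..x} (\<lambda>t. z *s (F t - G t)) = integral {0..x} (\<lambda>t. u t - v t)"
        using x by (intro integral_cong_AE_unit_interval[symmetric] ae) auto
      also have "\<dots> = integral {0..x} u - integral {0..x} v"
        using x by (intro Henstock_Kurzweil_Integration.integral_diff integrable_on_unit_subinterval
            integrable_L2 u v) auto
      finally show ?thesis
        unfolding matrix_vector_mult_diff_distrib F(6)[OF x] G(6)[OF x] by simp
    qed
  qed (use F G in auto)
qed

lemma T_minus_z_inj:
  assumes \<Delta>: "char_det \<noteq> 0" and fu: "(f, u) \<in> T" "(g, v) \<in> T"
    and eq: "(\<lambda>x. u x - z *s f x) =\<^sub>a\<^sub>e (\<lambda>x. v x - z *s g x)"
  shows "f =\<^sub>a\<^sub>e g"
proof -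
  obtain E E' where E: "(\<lambda>x. f x - g x) =\<^sub>a\<^sub>e E"
    "\<forall>x\<in>{0..1}. (E has_vector_derivative E' x) (at x within {0..1})" "continuous_on {0..1} E'"
    "E 0 $ 1 = 0" "E 1 $ 1 = 0" "E' 0 $ 2 = 0" "E' 1 $ 2 = 0"
    "\<forall>x\<in>{0..1}. A4 a d *v E' x = A4 a d *v E' 0 - integral {0..x} (\<lambda>t. z *s E t)"
    using T_diff_eigen[OF fu eq] by blast
  have s1: "oscillator_solution k1 (\<lambda>_. 0) (\<lambda>x. coord c1 (E x)) (\<lambda>x. coord c1 (E' x))"
    using coord_solution[OF _ z1 E(2)[rule_format] E(3) E(8)[rule_format]] by simp
  have s2: "oscillator_solution k2 (\<lambda>_. 0) (\<lambda>x. coord c2 (E x)) (\<lambda>x. coord c2 (E' x))"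
    using coord_solution[OF _ z2 E(2)[rule_format] E(3) E(8)[rule_format]] by simp
  \<comment> \<open>The boundary conditions at 0 leave only \<gamma>(0) and \<phi>'(0) free; the
    sign makes the starting values \<open>c1 * \<alpha>\<close> and
    \<open>c2 * \<alpha>\<close>.\<close>
  define \<alpha> where "\<alpha> = - (E 0 $ 2)"
  define \<beta> where "\<beta> = E' 0 $ 1"
  have i: "coord c1 (E 0) = c1 * \<alpha>" "coord c2 (E 0) = c2 * \<alpha>" "coord c1 (E' 0) = \<beta>" "coord c2 (E' 0) = \<beta>"
    using E by (simp_all add: coord_def \<alpha>_def \<beta>_def)
  have y1: "coord c1 (E x) = c1 * \<alpha> * cos (k1 * of_real x) + \<beta> * sin (k1 * of_real x) / k1"
    "coord c1 (E' x) = \<beta> * cos (k1 * of_real x) - c1 * \<alpha> * k1 * sin (k1 * of_real x)" if "x \<in> {0..1}" for x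
    using oscillator_homogeneous[OF k1 s1 that] unfolding i .
  have y2: "coord c2 (E x) = c2 * \<alpha> * cos (k2 * of_real x) + \<beta> * sin (k2 * of_real x) / k2"
    "coord c2 (E' x) = \<beta> * cos (k2 * of_real x) - c2 * \<alpha> * k2 * sin (k2 * of_real x)" if "x \<in> {0..1}" for x
    using oscillator_homogeneous[OF k2 s2 that] unfolding i .
  have b1: "c2 * coord c1 (E 1) = c1 * coord c2 (E 1)" "coord c1 (E' 1) = coord c2 (E' 1)"
    using E by (simp_all add: coord_def)
  define m where "m = cos k1 - cos k2"
  define p where "p = c2 * sin k1 / k1 - c1 * sin k2 / k2"
  define q where "q = c2 * k2 * sin k2 - c1 * k1 * sin k1"
  define t1 where "t1 = sin k1 / k1"
  define t2 where "t2 = sin k2 / k2"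
  have D: "m\<^sup>2 - p * q \<noteq> 0" using \<Delta> by (simp add: char_det_def m_def p_def q_def)
  have "c2 * (c1 * \<alpha> * cos k1 + \<beta> * t1) = c1 * (c2 * \<alpha> * cos k2 + \<beta> * t2)"
    using b1(1) y1(1)[of 1] y2(1)[of 1] by (simp add: t1_def t2_def)
  moreover have "p = c2 * t1 - c1 * t2" by (simp add: p_def t1_def t2_def)
  ultimately have e1: "m * \<alpha> + p * \<beta> = 0"
    using c_prod unfolding m_def by algebra
  have "\<beta> * cos k1 - c1 * \<alpha> * k1 * sin k1 = \<beta> * cos k2 - c2 * \<alpha> * k2 * sin k2"
    using b1(2) y1(2)[of 1] y2(2)[of 1] by simp
  then have e2: "q * \<alpha> + m * \<beta> = 0"
    unfolding m_def q_def by algebra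
  \<comment> \<open>Elimination, that is, multiplication by the adjugate of the system.\<close>
  have "(m\<^sup>2 - p * q) * \<alpha> = 0" "(m\<^sup>2 - p * q) * \<beta> = 0" using e1 e2 by algebra+
  then have 0: "\<alpha> = 0" "\<beta> = 0" using D by auto
  have E0: "E x = 0" if "x \<in> {0..1}" for x
    using y1(1)[OF that] y2(1)[OF that] unfolding 0
    by (intro coord_eqD[OF c_ne]) (simp_all add: coord_def)
  show ?thesis
    using E(1) AE_space[of unit_interval] unfolding ae_eq_def by eventually_elim (use E0 in auto)
qed

text \<open>A shooting argument: the starting values meet the conditions at 0, and \<alpha>, \<beta>
  are adjusted to meet those at 1. The offsets of the inhomogeneous solutions only change the
  right-hand side of the linear system, so its determinant is still \<open>char_det\<close>.\<close>

lemma T_minus_z_solve: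
  assumes \<Delta>: "char_det \<noteq> 0"
  obtains C where "\<And>h. h \<in> L2_space \<Longrightarrow>
    \<exists>f. (f, \<lambda>x. h x + z *s f x) \<in> T \<and> continuous_on {0..1} f \<and> L2_norm f \<le> C * L2_norm h"
proof -
  obtain K1 where K1: "controls_solutions k1 K1" by (rule oscillator_solve[OF k1])
  obtain K2 where K2: "controls_solutions k2 K2" by (rule oscillator_solve[OF k2])
  have K12: "0 \<le> K1" "0 \<le> K2" using K1 K2 unfolding controls_solutions_def by blast+
  define m where "m = cos k1 - cos k2"
  define p where "p = c2 * sin k1 / k1 - c1 * sin k2 / k2"
  define q where "q = c2 * k2 * sin k2 - c1 * k1 * sin k1"
  define D where "D = m\<^sup>2 - p * q"
  have D: "D \<noteq> 0" using \<Delta> by (simp add: char_det_def m_def p_def q_def D_def)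
  \<comment> \<open>Bounds both functionals \<open>coord c v / (of_real a - c)\<close>. Below,
    \<open>Q\<close> bounds \<alpha> and \<beta>, and \<open>Y\<close> bounds both solutions, each
    per unit of \<open>P\<close>; all are fixed before \<open>h\<close>, which makes the final
    constant uniform.\<close>
  define N where "N = (1 + norm c1) / norm (of_real a - c1) + (1 + norm c2) / norm (of_real a - c2)"
  define K where "K = K1 + K2"
  define c where "c = norm c1 + norm c2 + 1"
  define Q where "Q = (norm m + norm p + norm q) / norm D * (2 * c * K)"
  define Y where "Y = K * (c * Q + Q + 1)"
  have K: "K \<ge> 0" "K1 \<le> K" "K2 \<le> K" using K12 by (auto simp: K_def)
  have c: "1 \<le> c" "norm c1 \<le> c" "norm c2 \<le> c" by (auto simp: c_def add_nonneg_nonneg)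
  have N: "N \<ge> 0" by (auto simp: N_def add_nonneg_nonneg)
  have Q: "Q \<ge> 0" using K c by (auto simp: Q_def)
  show thesis
  proof (rule that[of "c / norm (c1 - c2) * (2 * Y * N)"])
    fix h assume h: "h \<in> L2_space"
    define P where "P = N * L2_norm h"
    have P: "P \<ge> 0" using N by (simp add: P_def)
    have hb: "(\<lambda>x. coord c (h x) / (of_real a - c)) integrable_on {0..1}"
        "\<And>x. x \<in> {0..1} \<Longrightarrow> norm (integral {0..x} (\<lambda>x. coord c (h x) / (of_real a - c))) \<le> P"
      if c: "(1 + norm c) / norm (of_real a - c) \<le> N" for c
    proof -
      have bl: "bounded_linear (\<lambda>v. coord c v / (of_real a - c))"
        by (intro bounded_linear_divide bounded_linear_compose[OF bounded_linear_divide bounded_linear_coord])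
      have i: "integrable unit_interval (\<lambda>x. coord c (h x) / (of_real a - c))"
        by (rule integrable_bounded_linear[OF bl integrable_L2[OF h]])
      show "norm (integral {0..x} (\<lambda>x. coord c (h x) / (of_real a - c))) \<le> P" if x: "x \<in> {0..1}" for x
      proof -
        have "norm (integral {0..x} (\<lambda>x. coord c (h x) / (of_real a - c)))
            \<le> (\<integral>x. norm (coord c (h x) / (of_real a - c)) \<partial>unit_interval)"
          by (rule norm_integral_le_lebesgue[OF i x])
        also have "\<dots> \<le> (\<integral>x. N * norm (h x) \<partial>unit_interval)"
        proof (intro integral_mono integrable_norm i integrable_mult_right integrable_L2 h)
          fix x
          have "norm (coord c (h x) / (of_real a - c)) \<le> (1 + norm c) * norm (h x) / norm (of_real a - c)"
            unfolding norm_divide by (intro divide_right_mono norm_coord_le norm_ge_zero)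
          also have "\<dots> = (1 + norm c) / norm (of_real a - c) * norm (h x)" by simp
          also have "\<dots> \<le> N * norm (h x)" by (intro mult_right_mono c norm_ge_zero)
          finally show "norm (coord c (h x) / (of_real a - c)) \<le> N * norm (h x)" .
        qed
        also have "\<dots> = N * (\<integral>x. norm (h x) \<partial>unit_interval)" by simp
        also have "\<dots> \<le> P"
          unfolding P_def by (intro mult_left_mono integral_norm_le_L2_norm h N)
        finally show ?thesis .
      qed
      show "(\<lambda>x. coord c (h x) / (of_real a - c)) integrable_on {0..1}"
        by (rule integrable_on_unit_subinterval[OF i]) simp_all
    qed
    have h1: "(1 + norm c1) / norm (of_real a - c1) \<le> N" and h2: "(1 + norm c2) / norm (of_real a - c2) \<le> N"
      by (auto simp: N_def)
    obtain r1 r1' where r1: "norm r1 \<le> K1 * P" "norm r1' \<le> K1 * P"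
      "\<forall>\<alpha> \<beta>. \<exists>y y'. oscillator_solution k1 (\<lambda>x. coord c1 (h x) / (of_real a - c1)) y y' \<and> y 0 = \<alpha> \<and> y' 0 = \<beta> \<and>
        y 1 = \<alpha> * cos k1 + \<beta> * sin k1 / k1 + r1 \<and> y' 1 = \<beta> * cos k1 - \<alpha> * k1 * sin k1 + r1' \<and>
        (\<forall>x\<in>{0..1}. norm (y x) \<le> K1 * (norm \<alpha> + norm \<beta> + P))"
      using controls_solutionsE[OF K1 hb(1)[OF h1] hb(2)[OF h1]] by blast
    obtain r2 r2' where r2: "norm r2 \<le> K2 * P" "norm r2' \<le> K2 * P"
      "\<forall>\<alpha> \<beta>. \<exists>y y'. oscillator_solution k2 (\<lambda>x. coord c2 (h x) / (of_real a - c2)) y y' \<and> y 0 = \<alpha> \<and> y' 0 = \<beta> \<and>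
        y 1 = \<alpha> * cos k2 + \<beta> * sin k2 / k2 + r2 \<and> y' 1 = \<beta> * cos k2 - \<alpha> * k2 * sin k2 + r2' \<and>
        (\<forall>x\<in>{0..1}. norm (y x) \<le> K2 * (norm \<alpha> + norm \<beta> + P))"
      using controls_solutionsE[OF K2 hb(1)[OF h2] hb(2)[OF h2]] by blast
    have Kb: "norm r1 \<le> K * P" "norm r1' \<le> K * P" "norm r2 \<le> K * P" "norm r2' \<le> K * P"
      using r1 r2 mult_right_mono[OF K(2) P] mult_right_mono[OF K(3) P] by linarith+
    have KP: "0 \<le> K * P" using K P by simp
    define e1 where "e1 = c1 * r2 - c2 * r1"
    define e2 where "e2 = r2' - r1'"
    have "norm e1 \<le> norm c1 * norm r2 + norm c2 * norm r1"
      unfolding e1_def norm_mult[symmetric] by (rule norm_triangle_ineq4)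
    also have "\<dots> \<le> c * (K * P) + c * (K * P)"
      using c Kb by (intro add_mono mult_mono) auto
    finally have be1: "norm e1 \<le> 2 * c * K * P" by (simp add: mult_ac)
    have "norm e2 \<le> norm r2' + norm r1'" unfolding e2_def by (rule norm_triangle_ineq4)
    also have "\<dots> \<le> 1 * (K * P) + 1 * (K * P)" using Kb by simp
    also have "\<dots> \<le> c * (K * P) + c * (K * P)" using c KP by (intro add_mono mult_right_mono)
    finally have be2: "norm e2 \<le> 2 * c * K * P" by (simp add: mult_ac)
    \<comment> \<open>Cramer's rule for the system with right-hand side \<open>e1\<close>,
      \<open>e2\<close>.\<close>
    define \<alpha> where "\<alpha> = (m * e1 - p * e2) / D"
    define \<beta> where "\<beta> = (m * e2 - q * e1) / D"
    have bnd: "norm ((s * e - s' * e') / D) \<le> Q * P"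
      if "norm e \<le> 2 * c * K * P" "norm e' \<le> 2 * c * K * P" "norm s + norm s' \<le> norm m + norm p + norm q"
      for s s' e e'
    proof -
      have "norm ((s * e - s' * e') / D) \<le> (norm s * norm e + norm s' * norm e') / norm D"
        unfolding norm_divide norm_mult[symmetric] by (intro divide_right_mono norm_triangle_ineq4 norm_ge_zero)
      also have "\<dots> \<le> (norm s * (2 * c * K * P) + norm s' * (2 * c * K * P)) / norm D"
        using that by (intro divide_right_mono add_mono mult_left_mono) auto
      also have "\<dots> = (norm s + norm s') * (2 * c * K * P) / norm D" by (simp add: algebra_simps)
      also have "\<dots> \<le> (norm m + norm p + norm q) * (2 * c * K * P) / norm D"
        using that c K P by (intro divide_right_mono mult_right_mono) auto
      also have "\<dots> = Q * P" by (simp add: Q_def)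
      finally show ?thesis .
    qed
    have b\<alpha>: "norm \<alpha> \<le> Q * P" unfolding \<alpha>_def by (rule bnd[OF be1 be2]) simp
    have b\<beta>: "norm \<beta> \<le> Q * P" unfolding \<beta>_def by (rule bnd[OF be2 be1]) simp
    obtain y1 y1' where y1: "oscillator_solution k1 (\<lambda>x. coord c1 (h x) / (of_real a - c1)) y1 y1'"
      "y1 0 = c1 * \<alpha>" "y1' 0 = \<beta>" "y1 1 = c1 * \<alpha> * cos k1 + \<beta> * sin k1 / k1 + r1"
      "y1' 1 = \<beta> * cos k1 - c1 * \<alpha> * k1 * sin k1 + r1'"
      "\<forall>x\<in>{0..1}. norm (y1 x) \<le> K1 * (norm (c1 * \<alpha>) + norm \<beta> + P)"
      using r1(3)[rule_format, of "c1 * \<alpha>" \<beta>] by blast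
    obtain y2 y2' where y2: "oscillator_solution k2 (\<lambda>x. coord c2 (h x) / (of_real a - c2)) y2 y2'"
      "y2 0 = c2 * \<alpha>" "y2' 0 = \<beta>" "y2 1 = c2 * \<alpha> * cos k2 + \<beta> * sin k2 / k2 + r2"
      "y2' 1 = \<beta> * cos k2 - c2 * \<alpha> * k2 * sin k2 + r2'"
      "\<forall>x\<in>{0..1}. norm (y2 x) \<le> K2 * (norm (c2 * \<alpha>) + norm \<beta> + P)"
      using r2(3)[rule_format, of "c2 * \<alpha>" \<beta>] by blast
    have ab: "D * \<alpha> = m * e1 - p * e2" "D * \<beta> = m * e2 - q * e1"
      using D by (simp_all add: \<alpha>_def \<beta>_def)
    have "D * (m * \<alpha> + p * \<beta> - e1) = 0" "D * (q * \<alpha> + m * \<beta> - e2) = 0"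
      using ab D_def by algebra+
    then have sys: "m * \<alpha> + p * \<beta> = e1" "q * \<alpha> + m * \<beta> = e2" using D by auto
    define t1 where "t1 = sin k1 / k1"
    define t2 where "t2 = sin k2 / k2"
    have pt: "p = c2 * t1 - c1 * t2" by (simp add: p_def t1_def t2_def)
    have "y1 1 = c1 * \<alpha> * cos k1 + \<beta> * t1 + r1" "y2 1 = c2 * \<alpha> * cos k2 + \<beta> * t2 + r2"
      using y1(4) y2(4) by (simp_all add: t1_def t2_def)
    then have bc1: "c2 * y1 1 = c1 * y2 1"
      using sys(1) pt c_prod e1_def m_def by algebra
    have bc2: "y1' 1 = y2' 1"
    proof -
      have "y1' 1 - y2' 1 = (q * \<alpha> + m * \<beta>) + r1' - r2'"
        unfolding y1(5) y2(5) m_def q_def by (simp add: algebra_simps)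
      then show ?thesis unfolding sys(2) e2_def by simp
    qed
    define f where "f x = uncoord c1 c2 (y1 x) (y2 x)" for x
    have f: "(f, \<lambda>x. h x + z *s f x) \<in> T" "continuous_on {0..1} f"
      unfolding f_def[abs_def] using c_prod y1(2,3) y2(2,3)
      by (intro uncoord_solution[OF h y1(1) y2(1) _ bc1 _ bc2]; simp add: mult.commute mult.left_commute)+
    have yb: "Kj * (norm (cj * \<alpha>) + norm \<beta> + P) \<le> Y * P"
      if "0 \<le> Kj" "Kj \<le> K" "norm cj \<le> c" for Kj cj
    proof -
      have "norm (cj * \<alpha>) \<le> c * (Q * P)" unfolding norm_mult using that b\<alpha> c by (intro mult_mono) auto
      then have "Kj * (norm (cj * \<alpha>) + norm \<beta> + P) \<le> K * (c * (Q * P) + Q * P + P)"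
        using that b\<beta> K P by (intro mult_mono add_mono) auto
      then show ?thesis by (simp add: Y_def algebra_simps)
    qed
    have bf: "norm (f x) \<le> c / norm (c1 - c2) * (2 * Y * P)" if x: "x \<in> {0..1}" for x
    proof -
      have "norm (f x) \<le> c / norm (c1 - c2) * (norm (y1 x) + norm (y2 x))"
        using norm_uncoord_le[of c1 c2 "y1 x" "y2 x"] by (simp add: f_def c_def add_ac)
      also have "\<dots> \<le> c / norm (c1 - c2) * (Y * P + Y * P)"
        using c by (intro mult_left_mono add_mono order_trans[OF y1(6)[rule_format, OF x]] order_trans[OF y2(6)[rule_format, OF x]] yb K12 K) auto
      finally show ?thesis by (simp add: mult_ac)
    qed
    have "L2_norm f \<le> c / norm (c1 - c2) * (2 * Y * P)"
      using bf by (intro L2_space_bounded(2) borel_measurable_continuous_unit_interval f) auto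
    then show "\<exists>f. (f, \<lambda>x. h x + z *s f x) \<in> T \<and> continuous_on {0..1} f \<and>
        L2_norm f \<le> c / norm (c1 - c2) * (2 * Y * N) * L2_norm h"
      using f by (intro exI[of _ f]) (simp add: P_def mult.assoc)
  qed
qed

lemma T_L2: "(f, u) \<in> T \<Longrightarrow> f \<in> L2_space" "(f, u) \<in> T \<Longrightarrow> u \<in> L2_space"
  unfolding matrix_times_op_def D_op_def Dom_D_def W22_def by blast+

theorem in_resolvent_set:
  assumes \<Delta>: "char_det \<noteq> 0"
  shows "z \<in> resolvent_set T"
proof -
  obtain C where C: "\<And>h. h \<in> L2_space \<Longrightarrow>
    \<exists>f. (f, \<lambda>x. h x + z *s f x) \<in> T \<and> continuous_on {0..1} f \<and> L2_norm f \<le> C * L2_norm h"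
    using T_minus_z_solve[OF \<Delta>] by blast
  have bz: "bounded_linear (\<lambda>v :: complex^2. - (z *s v))"
    by (intro linear_conv_bounded_linear[THEN iffD1] linearI)
      (simp_all add: vec_eq_iff forall_2 algebra_simps scaleR_conv_of_real[where 'a = complex])
  show ?thesis
    unfolding resolvent_set_def mem_Collect_eq
  proof (intro conjI ballI exI[of _ C])
    fix h assume "h \<in> L2_space"
    then obtain f where "(f, \<lambda>x. h x + z *s f x) \<in> T" using C by blast
    then show "\<exists>(f, u)\<in>T. (\<lambda>x. u x - z *s f x) =\<^sub>a\<^sub>e h"
      by (intro bexI[of _ "(f, \<lambda>x. h x + z *s f x)"]) (auto simp: ae_eq_def)
  next
    show "case p of (f, u) \<Rightarrow> \<forall>(f', u')\<in>T.
        (\<lambda>x. u x - z *s f x) =\<^sub>a\<^sub>e (\<lambda>x. u' x - z *s f' x) \<longrightarrow> f =\<^sub>a\<^sub>e f'" if "p \<in> T" for p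
    proof (cases p)
      case (Pair f u)
      show ?thesis
        unfolding Pair prod.case
      proof (intro ballI)
        fix p' assume "p' \<in> T"
        then show "case p' of (f', u') \<Rightarrow>
            (\<lambda>x. u x - z *s f x) =\<^sub>a\<^sub>e (\<lambda>x. u' x - z *s f' x) \<longrightarrow> f =\<^sub>a\<^sub>e f'"
          using T_minus_z_inj[OF \<Delta>] \<open>p \<in> T\<close> Pair by (cases p') simp
      qed
    qed
  next
    fix p assume "p \<in> T"
    then obtain f u where p: "p = (f, u)" "(f, u) \<in> T" by (cases p) auto
    define h where "h x = u x - z *s f x" for x
    have "h \<in> L2_space"
      using L2_space_add[OF _ L2_space_linear[OF _ bz], of u f] T_L2[OF p(2)]
      by (simp add: h_def[abs_def])
    then obtain g where g: "(g, \<lambda>x. h x + z *s g x) \<in> T" "L2_norm g \<le> C * L2_norm h"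
      using C by blast
    \<comment> \<open>By uniqueness the constructed solution agrees with the given \<open>f\<close>
      almost everywhere, so its bound carries over.\<close>
    have "f =\<^sub>a\<^sub>e g"
      by (rule T_minus_z_inj[OF \<Delta> p(2) g(1)]) (simp add: ae_eq_def h_def)
    then have "L2_norm f = L2_norm g"
      by (intro L2_norm_cong L2_spaceD T_L2[OF p(2)] T_L2[OF g(1)])
    then show "case p of (f, u) \<Rightarrow> L2_norm f \<le> C * L2_norm (\<lambda>x. u x - z *s f x)"
      using g(2) p by (simp add: h_def[abs_def])
  qed
qed

text \<open>A kernel vector of the singular system gives a continuous eigenfunction. It is not
  almost everywhere zero, since its starting values are not both zero, so the injectivity clause of
  the resolvent set fails.\<close>

theorem in_Spec:
  assumes \<Delta>: "char_det = 0"
  shows "z \<in> Spec T"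
proof (rule ccontr)
  assume "z \<notin> Spec T"
  then have "z \<in> resolvent_set T" by (simp add: Spec_def)
  then have inj: "\<forall>(f, u)\<in>T. \<forall>(g, v)\<in>T.
      (\<lambda>x. u x - z *s f x) =\<^sub>a\<^sub>e (\<lambda>x. v x - z *s g x) \<longrightarrow> f =\<^sub>a\<^sub>e g"
    unfolding resolvent_set_def by blast
  define m where "m = cos k1 - cos k2"
  define p where "p = c2 * sin k1 / k1 - c1 * sin k2 / k2"
  define q where "q = c2 * k2 * sin k2 - c1 * k1 * sin k1"
  have D: "m\<^sup>2 = p * q" using \<Delta> by (simp add: char_det_def m_def p_def q_def)
  \<comment> \<open>If \<open>p = 0\<close> then \<open>m = 0\<close>, and (0, 1) is a kernel
    vector; otherwise (p, -m) is one.\<close>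
  have "\<exists>\<alpha> \<beta>. m * \<alpha> + p * \<beta> = 0 \<and> q * \<alpha> + m * \<beta> = 0 \<and> (\<alpha> \<noteq> 0 \<or> \<beta> \<noteq> 0)"
  proof (cases "p = 0")
    case True
    then have "m = 0" using D by simp
    with True show ?thesis
      by - (rule exI[of _ 0], rule exI[of _ 1], simp)
  next
    case False
    then show ?thesis using D
      by - (rule exI[of _ p], rule exI[of _ "-m"], simp add: power2_eq_square mult.commute)
  qed
  then obtain \<alpha> \<beta> where ab: "m * \<alpha> + p * \<beta> = 0" "q * \<alpha> + m * \<beta> = 0" "\<alpha> \<noteq> 0 \<or> \<beta> \<noteq> 0" by blast
  \<comment> \<open>The zero right-hand side keeps the form \<open>(\<lambda>_. 0) x\<close> to
    match \<open>uncoord_solution\<close>; a primitive bounded by 0 forces both offsets to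
    vanish.\<close>
  have sol: "\<exists>y y'. oscillator_solution k (\<lambda>x. coord c ((\<lambda>_. 0) x) / (of_real a - c)) y y' \<and> y 0 = \<alpha>' \<and> y' 0 = \<beta>
      \<and> y 1 = \<alpha>' * cos k + \<beta> * sin k / k \<and> y' 1 = \<beta> * cos k - \<alpha>' * k * sin k"
    if k: "k \<noteq> 0" for k \<alpha>' c
  proof -
    have z: "(\<lambda>x. coord c ((\<lambda>_. 0) x) / (of_real a - c)) = (\<lambda>_. 0)" by (simp add: coord_def)
    obtain K where K: "controls_solutions k K" by (rule oscillator_solve[OF k])
    have i: "(\<lambda>_. 0 :: complex) integrable_on {0..1::real}"
      and b: "\<And>x. x \<in> {0..1} \<Longrightarrow> norm (integral {0..x} (\<lambda>_. 0 :: complex)) \<le> (0::real)"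
      by (rule integrable_0) simp
    obtain r r' where r: "norm r \<le> K * 0" "norm r' \<le> K * 0"
      "\<forall>\<alpha> \<beta>. \<exists>y y'. oscillator_solution k (\<lambda>_. 0) y y' \<and> y 0 = \<alpha> \<and> y' 0 = \<beta> \<and>
        y 1 = \<alpha> * cos k + \<beta> * sin k / k + r \<and> y' 1 = \<beta> * cos k - \<alpha> * k * sin k + r' \<and>
        (\<forall>x\<in>{0..1}. norm (y x) \<le> K * (norm \<alpha> + norm \<beta> + 0))"
      using controls_solutionsE[OF K i b] by blast
    have 0: "r = 0" "r' = 0" using r(1,2) by simp_all
    show ?thesis using r(3)[unfolded 0 add_0_right, rule_format, of \<alpha>' \<beta>] unfolding z by blast
  qed
  obtain y1 y1' where y1: "oscillator_solution k1 (\<lambda>x. coord c1 ((\<lambda>_. 0) x) / (of_real a - c1)) y1 y1'"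
    "y1 0 = c1 * \<alpha>" "y1' 0 = \<beta>" "y1 1 = c1 * \<alpha> * cos k1 + \<beta> * sin k1 / k1"
    "y1' 1 = \<beta> * cos k1 - c1 * \<alpha> * k1 * sin k1"
    using sol[OF k1, where \<alpha>' = "c1 * \<alpha>" and c = c1] by blast
  obtain y2 y2' where y2: "oscillator_solution k2 (\<lambda>x. coord c2 ((\<lambda>_. 0) x) / (of_real a - c2)) y2 y2'"
    "y2 0 = c2 * \<alpha>" "y2' 0 = \<beta>" "y2 1 = c2 * \<alpha> * cos k2 + \<beta> * sin k2 / k2"
    "y2' 1 = \<beta> * cos k2 - c2 * \<alpha> * k2 * sin k2"
    using sol[OF k2, where \<alpha>' = "c2 * \<alpha>" and c = c2] by blast
  define t1 where "t1 = sin k1 / k1"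
  define t2 where "t2 = sin k2 / k2"
  have pt: "p = c2 * t1 - c1 * t2" by (simp add: p_def t1_def t2_def)
  have "y1 1 = c1 * \<alpha> * cos k1 + \<beta> * t1" "y2 1 = c2 * \<alpha> * cos k2 + \<beta> * t2"
    using y1(4) y2(4) by (simp_all add: t1_def t2_def)
  then have bc1: "c2 * y1 1 = c1 * y2 1"
    using ab(1) pt c_prod m_def by algebra
  have bc2: "y1' 1 = y2' 1"
  proof -
    have "y1' 1 - y2' 1 = q * \<alpha> + m * \<beta>"
      unfolding y1(5) y2(5) m_def q_def by (simp add: algebra_simps)
    then show ?thesis unfolding ab(2) by simp
  qed
  define f where "f x = uncoord c1 c2 (y1 x) (y2 x)" for x
  have 0: "(\<lambda>_. 0) \<in> L2_space" by (intro L2_space_continuous continuous_intros)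
  have f: "(f, \<lambda>x. 0 + z *s f x) \<in> T" "continuous_on {0..1} f"
    unfolding f_def[abs_def] using y1(2,3) y2(2,3)
    by (intro uncoord_solution[OF 0 y1(1) y2(1) _ bc1 _ bc2]; simp add: mult.commute mult.left_commute)+
  have T0: "(\<lambda>_. 0, \<lambda>_. 0) \<in> T"
    unfolding T_iff
    by (intro conjI 0 exI[of _ "\<lambda>_. 0"]) (simp_all add: C1_representative_def ae_eq_def)
  have "f =\<^sub>a\<^sub>e (\<lambda>_. 0)"
    using bspec[OF bspec[OF inj f(1), unfolded prod.case] T0, unfolded prod.case] by (simp add: ae_eq_def)
  then have f0: "f x = 0" if "x \<in> {0..1}" for x
    unfolding ae_eq_def by (rule continuous_eq_if_AE_eq[OF _ f(2) continuous_on_const that])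
  have y0: "y1 x = 0" "y2 x = 0" if "x \<in> {0..1}" for x
  proof -
    have u: "uncoord c1 c2 (y1 x) (y2 x) = 0" using f0[OF that] by (simp only: f_def)
    show "y1 x = 0" "y2 x = 0"
      using coord_uncoord[OF c_ne, of "y1 x" "y2 x"] unfolding u by (simp_all add: coord_def)
  qed
  have "c1 \<noteq> 0" using c_prod by auto
  then have "\<alpha> = 0" using y0(1)[of 0] y1(2) by simp
  moreover have "\<beta> = 0"
  proof -
    have "((\<lambda>_. 0) has_vector_derivative y1' 0) (at 0 within {0..1})"
    proof (rule has_vector_derivative_transform)
      show "(y1 has_vector_derivative y1' 0) (at 0 within {0..1})"
        by (rule oscillator_solutionD(1)[OF y1(1)]) simp
      show "0 = y1 x" if "x \<in> {0..1}" for x using y0(1)[OF that] by (rule sym)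
    qed simp
    moreover have "at (0::real) within {0..1} \<noteq> bot" by (simp add: at_within_Icc_at_right)
    ultimately have "y1' 0 = 0"
      by (intro vector_derivative_unique_within[OF _ _ has_vector_derivative_const]) auto
    then show ?thesis using y1(3) by simp
  qed
  ultimately show False using ab(3) by simp
qed

end

section \<open>Zeros of the characteristic function\<close>

text \<open>With y = Im z, the squared norm of cos z is cos^2(Re z) + sinh^2 y. It lies between
  sinh^2 y and cosh^2 y, and exp(-|y|) <= 1 gives the first bound.\<close>

lemma norm_cos_bounds:
  fixes z :: complex
  shows "(exp \<bar>Im z\<bar> - 1) / 2 \<le> norm (cos z)" "\<bar>Im z\<bar> \<le> norm (cos z)" "norm (cos z) \<le> exp \<bar>Im z\<bar>"
proof -
  let ?s = "(exp (Im z) - inverse (exp (Im z))) / 2"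
  have sq: "(norm (cos z))\<^sup>2 = (cos (Re z))\<^sup>2 + ?s\<^sup>2"
    unfolding norm_cos_squared by (simp add: power_divide)
  have "?s\<^sup>2 \<le> (norm (cos z))\<^sup>2" unfolding sq by simp
  then have s: "\<bar>?s\<bar> \<le> norm (cos z)" by (simp add: abs_le_square_iff[symmetric])
  with real_le_abs_sinh[of "Im z"] show "\<bar>Im z\<bar> \<le> norm (cos z)" by linarith
  have e1: "exp (- \<bar>Im z\<bar>) \<le> 1" by simp
  have "\<bar>?s\<bar> = (exp \<bar>Im z\<bar> - exp (- \<bar>Im z\<bar>)) / 2"
    by (cases "Im z \<ge> 0") (auto simp: exp_minus[symmetric] abs_if diff_divide_distrib)
  with s e1 show "(exp \<bar>Im z\<bar> - 1) / 2 \<le> norm (cos z)" by argo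
  show "norm (cos z) \<le> exp \<bar>Im z\<bar>"
  proof (rule power2_le_imp_le)
    have "(norm (cos z))\<^sup>2 \<le> 1 + ?s\<^sup>2" unfolding sq by (simp add: cos_squared_eq)
    also have "\<dots> = ((exp (Im z) + inverse (exp (Im z))) / 2)\<^sup>2"
      by (simp add: power2_eq_square field_simps)
    also have "\<dots> \<le> (exp \<bar>Im z\<bar>)\<^sup>2"
      by (intro power_mono) (auto simp: exp_minus[symmetric] abs_if)
    finally show "(norm (cos z))\<^sup>2 \<le> (exp \<bar>Im z\<bar>)\<^sup>2" .
  qed simp
qed

lemma two_cosine_zeros_in_strip:
  fixes \<mu> \<delta> \<sigma> :: real
  assumes \<mu>: "\<mu> \<ge> 1" and \<delta>: "\<delta> \<noteq> 0" "\<bar>\<delta>\<bar> < \<sigma>"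
  obtains Y where "Y > 0"
    "\<And>w. 2 - (1 + of_real \<mu>) * cos (of_real \<delta> * w) + (of_real \<mu> - 1) * cos (of_real \<sigma> * w) = (0::complex) \<Longrightarrow> \<bar>Im w\<bar> \<le> Y"
proof (cases "\<mu> = 1")
  case True
  \<comment> \<open>Here the cosine equals 1, and \<open>\<bar>Im z\<bar> \<le> norm (cos z)\<close>
    yields a bound that is positive, as the parabola requires.\<close>
  show thesis
  proof (rule that[of "1 / \<bar>\<delta>\<bar>"])
    fix w assume "2 - (1 + of_real \<mu>) * cos (of_real \<delta> * w) + (of_real \<mu> - 1) * cos (of_real \<sigma> * w) = (0::complex)"
    then have "cos (of_real \<delta> * w) = 1" using True by simp
    then have "\<bar>\<delta> * Im w\<bar> \<le> 1" using norm_cos_bounds(2)[of "of_real \<delta> * w"] by simp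
    then show "\<bar>Im w\<bar> \<le> 1 / \<bar>\<delta>\<bar>" using \<delta> by (simp add: abs_mult field_simps)
  qed (use \<delta> in simp)
next
  case False
  then have \<mu>1: "\<mu> > 1" using \<mu> by simp
  define \<eta> where "\<eta> = \<sigma> - \<bar>\<delta>\<bar>"
  have \<eta>: "\<eta> > 0" using \<delta> by (simp add: \<eta>_def)
  \<comment> \<open>Comparing norms gives (\<mu> - 1) E \<eta> y / 2 <= (1 + \<mu>) E + 2 <= (3 +
    \<mu>) E with E = exp(|\<delta>| y); cancelling E leaves this constant.\<close>
  show thesis
  proof (rule that[of "2 * (3 + \<mu>) / ((\<mu> - 1) * \<eta>)"])
    show "2 * (3 + \<mu>) / ((\<mu> - 1) * \<eta>) > 0" using \<mu>1 \<eta> by simp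
    fix w assume 0: "2 - (1 + of_real \<mu>) * cos (of_real \<delta> * w) + (of_real \<mu> - 1) * cos (of_real \<sigma> * w) = (0::complex)"
    define y where "y = \<bar>Im w\<bar>"
    define E where "E = exp (\<bar>\<delta>\<bar> * y)"
    have E: "E \<ge> 1" by (simp add: E_def y_def)
    have "(of_real \<mu> - 1) * cos (of_real \<sigma> * w) = (1 + of_real \<mu>) * cos (of_real \<delta> * w) - (2::complex)"
      using 0 by algebra
    then have "norm (of_real (\<mu> - 1) * cos (of_real \<sigma> * w)) = norm (of_real (1 + \<mu>) * cos (of_real \<delta> * w) - (2::complex))"
      by simp
    also have "\<dots> \<le> norm (of_real (1 + \<mu>) * cos (of_real \<delta> * w)) + 2"
      using norm_triangle_ineq4[of "of_real (1 + \<mu>) * cos (of_real \<delta> * w)" 2] by simp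
    finally have "(\<mu> - 1) * norm (cos (of_real \<sigma> * w)) \<le> (1 + \<mu>) * norm (cos (of_real \<delta> * w)) + 2"
      unfolding norm_mult norm_of_real using \<mu> by simp
    moreover have "norm (cos (of_real \<delta> * w)) \<le> E"
      using norm_cos_bounds(3)[of "of_real \<delta> * w"] by (simp add: E_def y_def abs_mult)
    then have "(1 + \<mu>) * norm (cos (of_real \<delta> * w)) \<le> (1 + \<mu>) * E"
      using \<mu> by (intro mult_left_mono) auto
    \<comment> \<open>The larger frequency contributes exp(\<sigma> y) = E exp(\<eta> y) >= E (1 +
      \<eta> y), and E >= 1 absorbs the - 1 of the lower bound for the cosine.\<close>
    moreover have "E * \<eta> * y / 2 \<le> norm (cos (of_real \<sigma> * w))"
    proof -
      have "E * (1 + \<eta> * y) \<le> E * exp (\<eta> * y)"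
        using E by (intro mult_left_mono exp_ge_add_one_self) auto
      also have "\<dots> = exp (\<bar>Im (of_real \<sigma> * w)\<bar>)"
        using \<delta> by (simp add: E_def y_def \<eta>_def exp_add[symmetric] abs_mult algebra_simps)
      finally have "E * (1 + \<eta> * y) - 1 \<le> exp (\<bar>Im (of_real \<sigma> * w)\<bar>) - 1" by simp
      then have "E * \<eta> * y \<le> exp (\<bar>Im (of_real \<sigma> * w)\<bar>) - 1" using E by (simp add: algebra_simps)
      then have "E * \<eta> * y / 2 \<le> (exp (\<bar>Im (of_real \<sigma> * w)\<bar>) - 1) / 2" by (rule divide_right_mono) simp
      then show ?thesis using norm_cos_bounds(1) by (rule order_trans)
    qed
    then have "(\<mu> - 1) * (E * \<eta> * y / 2) \<le> (\<mu> - 1) * norm (cos (of_real \<sigma> * w))"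
      using \<mu> by (intro mult_left_mono) auto
    ultimately have "(\<mu> - 1) * (E * \<eta> * y / 2) \<le> (1 + \<mu>) * E + 2 * E"
      using E by linarith
    then have "E * ((\<mu> - 1) * \<eta> * y) \<le> E * (2 * (3 + \<mu>))" by (simp add: algebra_simps)
    then have "(\<mu> - 1) * \<eta> * y \<le> 2 * (3 + \<mu>)" using E by simp
    then show "\<bar>Im w\<bar> \<le> 2 * (3 + \<mu>) / ((\<mu> - 1) * \<eta>)"
      using \<mu>1 \<eta> by (simp add: y_def pos_le_divide_eq mult_ac)
  qed
qed

lemma two_cosine_real_zeros_unbounded:
  fixes \<mu> \<delta> \<sigma> N :: real
  assumes \<mu>: "\<mu> \<ge> 1" and \<delta>: "\<delta> \<noteq> 0"
  obtains x where "x > N" "2 - (1 + \<mu>) * cos (\<delta> * x) + (\<mu> - 1) * cos (\<sigma> * x) = 0"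
proof -
  define g where "g x = 2 - (1 + \<mu>) * cos (\<delta> * x) + (\<mu> - 1) * cos (\<sigma> * x)" for x
  obtain n :: nat where n: "N * \<bar>\<delta>\<bar> / (2 * pi) < real n"
    using reals_Archimedean2 by blast
  define l where "l = real (2 * n) * pi / \<bar>\<delta>\<bar>"
  define r where "r = real (2 * n + 1) * pi / \<bar>\<delta>\<bar>"
  have lr: "l \<le> r" "N < l" using n \<delta> by (auto simp: l_def r_def field_simps)
  have c: "cos (\<delta> * x) = cos (\<bar>\<delta>\<bar> * x)" for x by (simp add: abs_if)
  have "\<bar>\<delta>\<bar> * l = real (2 * n) * pi" "\<bar>\<delta>\<bar> * r = real (2 * n + 1) * pi" using \<delta> by (simp_all add: l_def r_def)
  then have cl: "cos (\<delta> * l) = 1" and cr: "cos (\<delta> * r) = -1" unfolding c by (simp_all only: cos_npi) simp_all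
  have "(\<mu> - 1) * cos (\<sigma> * l) \<le> (\<mu> - 1) * 1" "(\<mu> - 1) * (-1) \<le> (\<mu> - 1) * cos (\<sigma> * r)"
    using \<mu> by (intro mult_left_mono; simp)+
  then have "g l \<le> 0" "0 \<le> g r" using \<mu> by (simp_all add: g_def cl cr)
  moreover have "continuous_on {l..r} g" unfolding g_def[abs_def] by (intro continuous_intros)
  ultimately obtain x where "l \<le> x" "x \<le> r" "g x = 0" using IVT'[of g l 0 r] lr(1) by blast
  then show thesis using lr(2) by (intro that[of x]) (auto simp: g_def)
qed

section \<open>The spectrum as the zero set of a two-frequency function\<close>

text \<open>Since \<open>c1 * c2 = 1\<close>, the squares of sines and cosines add up to 2. What
  remains is - 2 cos k1 cos k2 - 2 \<nu> sin k1 sin k2, to which the addition theorems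
  apply.\<close>

lemma (in oscillator_pair) char_det_eq:
  "char_det = 2 - (1 + (c2\<^sup>2 * (k2 / k1) + c1\<^sup>2 * (k1 / k2)) / 2) * cos (k1 - k2)
     + ((c2\<^sup>2 * (k2 / k1) + c1\<^sup>2 * (k1 / k2)) / 2 - 1) * cos (k1 + k2)"
proof -
  define r where "r = k2 / k1"
  define r' where "r' = k1 / k2"
  have r: "c2 * sin k1 / k1 * (c2 * k2 * sin k2) = c2\<^sup>2 * r * (sin k1 * sin k2)"
    "c2 * sin k1 / k1 * (c1 * k1 * sin k1) = c1 * c2 * (sin k1)\<^sup>2"
    "c1 * sin k2 / k2 * (c2 * k2 * sin k2) = c1 * c2 * (sin k2)\<^sup>2"
    "c1 * sin k2 / k2 * (c1 * k1 * sin k1) = c1\<^sup>2 * r' * (sin k1 * sin k2)"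
    using k1 k2 by (simp_all add: r_def r'_def power2_eq_square)
  have "char_det = (cos k1 - cos k2)\<^sup>2 + (sin k1)\<^sup>2 + (sin k2)\<^sup>2 - (c2\<^sup>2 * r + c1\<^sup>2 * r') * (sin k1 * sin k2)"
    unfolding char_det_def left_diff_distrib right_diff_distrib r c_prod by (simp add: algebra_simps)
  also have "\<dots> = 2 - (1 + (c2\<^sup>2 * r + c1\<^sup>2 * r') / 2) * cos (k1 - k2)
     + ((c2\<^sup>2 * r + c1\<^sup>2 * r') / 2 - 1) * cos (k1 + k2)"
  proof -
    define \<nu> where "\<nu> = (c2\<^sup>2 * r + c1\<^sup>2 * r') / 2"
    have "c2\<^sup>2 * r + c1\<^sup>2 * r' = 2 * \<nu>" by (simp add: \<nu>_def)
    then show ?thesis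
      unfolding \<nu>_def[symmetric] cos_add cos_diff
      using sin_cos_squared_add[of k1] sin_cos_squared_add[of k2] by algebra
  qed
  finally show ?thesis unfolding r_def r'_def .
qed

text \<open>Writing z as the sign of a + d times w^2 makes both frequencies positive real multiples
  of the same \<open>w\<close>, so the determinant becomes a function of \<open>w\<close> with real
  coefficients and real frequencies.\<close>

lemma Spec_A4_iff:
  fixes a d :: real
  assumes ad: "a * d > -1" and gap: "\<bar>a - d\<bar> > 2" and tr: "a + d \<noteq> 0"
  obtains \<mu> \<delta> \<sigma> :: real where "\<mu> \<ge> 1" "\<delta> \<noteq> 0" "\<bar>\<delta>\<bar> < \<sigma>"
    "\<And>w :: complex. w \<noteq> 0 \<Longrightarrow> of_real (sgn (a + d)) * w\<^sup>2 \<in> Spec (matrix_times_op (A4 a d) D_op) \<longleftrightarrow>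
       2 - (1 + of_real \<mu>) * cos (of_real \<delta> * w) + (of_real \<mu> - 1) * cos (of_real \<sigma> * w) = 0"
proof -
  define s where "s = sgn (a + d)"
  have s: "s * s = 1" "s * (a + d) > 0" using tr by (auto simp: s_def sgn_if)
  have "2\<^sup>2 < \<bar>a - d\<bar>\<^sup>2" using gap by (intro power_strict_mono) auto
  then have disc: "(a - d)\<^sup>2 - 4 > 0" by simp
  define q where "q = sqrt ((a - d)\<^sup>2 - 4)"
  have q: "q > 0" "q * q = (a - d)\<^sup>2 - 4" using disc by (auto simp: q_def)
  define c1 where "c1 = (a - d + q) / 2"
  define c2 where "c2 = (a - d - q) / 2"
  have c: "c1 + c2 = a - d" "c1 * c2 = 1" "c1 \<noteq> c2"
    using q by (auto simp: c1_def c2_def power2_eq_square field_simps)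
  have lam: "(a - c1) * (a - c2) = a * d + 1" "(a - c1) + (a - c2) = a + d"
    using c(1,2) by algebra+
  have "s * (a - c1) * (s * (a - c2)) > 0" "s * (a - c1) + s * (a - c2) > 0"
    using ad s lam by (simp_all add: algebra_simps)
  \<comment> \<open>Two reals with positive product and positive sum are both positive.\<close>
  then have pos: "s * (a - c1) > 0" "s * (a - c2) > 0"
    by (smt (verit) mult_neg_pos mult_nonneg_nonpos zero_less_mult_iff)+
  \<comment> \<open>Chosen so that \<open>(a - c1) * m1\<^sup>2 = s\<close>, hence the frequency
    \<open>m1 * w\<close> belongs to \<open>s * w\<^sup>2\<close>; likewise
    \<open>m2\<close>.\<close>
  define m1 where "m1 = 1 / sqrt (s * (a - c1))"
  define m2 where "m2 = 1 / sqrt (s * (a - c2))"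
  have m: "m1 > 0" "m2 > 0" "s * (a - c1) * m1\<^sup>2 = 1" "s * (a - c2) * m2\<^sup>2 = 1"
  proof -
    have "x * (1 / sqrt x)\<^sup>2 = 1" if "x > 0" for x :: real using that by (simp add: power_divide)
    then show "s * (a - c1) * m1\<^sup>2 = 1" "s * (a - c2) * m2\<^sup>2 = 1"
      using pos unfolding m1_def m2_def by blast+
  qed (use pos in \<open>simp_all add: m1_def m2_def\<close>)
  have mne: "m1 \<noteq> m2"
  proof
    assume "m1 = m2"
    then have "s * (a - c1) = s * (a - c2)" using m pos by (metis mult_cancel_right zero_neq_one mult_zero_right)
    then show False using s c by auto
  qed
  define \<mu> where "\<mu> = (c2\<^sup>2 * (m2 / m1) + c1\<^sup>2 * (m1 / m2)) / 2"
  show thesis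
  proof (rule that[of \<mu> "m1 - m2" "m1 + m2"])
    \<comment> \<open>The cross term is 2 m1 m2 because \<open>c1 * c2 = 1\<close>; division by it
      gives \<mu> >= 1.\<close>
    have "0 \<le> (c2 * m2 - c1 * m1)\<^sup>2" by simp
    also have "\<dots> = (c2 * m2)\<^sup>2 + (c1 * m1)\<^sup>2 - 2 * (c1 * c2) * (m1 * m2)"
      by (simp add: power2_eq_square algebra_simps)
    finally have "2 * (m1 * m2) \<le> (c2 * m2)\<^sup>2 + (c1 * m1)\<^sup>2" using c by simp
    then show "\<mu> \<ge> 1" using m(1,2) by (simp add: \<mu>_def power2_eq_square field_simps)
    show "m1 - m2 \<noteq> 0" "\<bar>m1 - m2\<bar> < m1 + m2" using mne m by auto
    fix w :: complex assume w: "w \<noteq> 0"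
    let ?k1 = "of_real m1 * w" and ?k2 = "of_real m2 * w"
    have ev: "(of_real a - of_real c) * (of_real n * w)\<^sup>2 = of_real s * w\<^sup>2"
      if "s * (a - c) * n\<^sup>2 = 1" for c n
    proof -
      have "(a - c) * n\<^sup>2 = s" using that s(1) by algebra
      then have "of_real ((a - c) * n\<^sup>2) * w\<^sup>2 = of_real s * w\<^sup>2" by simp
      then show ?thesis by (simp add: power_mult_distrib algebra_simps)
    qed
    interpret oscillator_pair a d "of_real c1" "of_real c2" "of_real s * w\<^sup>2" ?k1 ?k2
    proof
      show "of_real c1 + of_real c2 = (of_real (a - d) :: complex)" using c(1) by (metis of_real_add)
      show "of_real c1 * of_real c2 = (1 :: complex)" using c(2) by (metis of_real_mult of_real_1)
    qed (use ad c m w s ev in auto)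
    have quot: "?k2 / ?k1 = of_real (m2 / m1)" "?k1 / ?k2 = of_real (m1 / m2)" using w by simp_all
    have \<mu>': "((of_real c2)\<^sup>2 * (?k2 / ?k1) + (of_real c1)\<^sup>2 * (?k1 / ?k2)) / 2 = of_real \<mu>"
      unfolding quot by (simp add: \<mu>_def)
    have "char_det = 2 - (1 + of_real \<mu>) * cos (of_real (m1 - m2) * w) + (of_real \<mu> - 1) * cos (of_real (m1 + m2) * w)"
      unfolding char_det_eq \<mu>' by (simp add: algebra_simps)
    then show "of_real (sgn (a + d)) * w\<^sup>2 \<in> Spec (matrix_times_op (A4 a d) D_op) \<longleftrightarrow>
       2 - (1 + of_real \<mu>) * cos (of_real (m1 - m2) * w) + (of_real \<mu> - 1) * cos (of_real (m1 + m2) * w) = 0"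
      using in_Spec in_resolvent_set unfolding s_def[symmetric] Spec_def by fastforce
  qed
qed

text \<open>Match the imaginary part first: 2 r y = 2 Re w Im w fixes \<open>r\<close>. The
  remaining real difference \<open>t\<close> factors as (y^2 - (Im w)^2) ((Re w)^2 / y^2 + 1), so it
  is nonnegative in the strip.\<close>

lemma power2_in_parabola_region:
  fixes w :: complex
  assumes "y > 0" "\<bar>Im w\<bar> \<le> y"
  obtains r t where "t \<ge> 0" "w\<^sup>2 = (of_real r + \<i> * of_real y)\<^sup>2 + of_real t"
proof
  define r where "r = Re w * Im w / y"
  define t where "t = (Re w)\<^sup>2 - (Im w)\<^sup>2 - (r\<^sup>2 - y\<^sup>2)"
  have "(Im w)\<^sup>2 \<le> y\<^sup>2" using assms by (simp add: abs_le_square_iff[symmetric])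
  moreover have "t = (y\<^sup>2 - (Im w)\<^sup>2) * ((Re w)\<^sup>2 / y\<^sup>2 + 1)"
    using assms(1) by (simp add: t_def r_def power_divide power_mult_distrib field_simps)
  ultimately show "t \<ge> 0" by simp
  have "Re w * Im w = r * y" "Im w * Re w = r * y" using assms(1) by (simp_all add: r_def)
  then show "w\<^sup>2 = (of_real r + \<i> * of_real y)\<^sup>2 + of_real t"
    by (auto simp: complex_eq_iff power2_eq_square t_def)
qed

theorem theorem25:
  fixes a d :: real
  assumes "a * d > -1" and "\<bar>a - d\<bar> > 2" and "a + d \<noteq> 0"
  shows "infinite (Spec (matrix_times_op (A4 a d) D_op)) \<and>
    (\<exists>y\<^sub>0 :: real. y\<^sub>0 > 0 \<and>
      (a + d > 0 \<longrightarrow>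
         Spec (matrix_times_op (A4 a d) D_op)
           \<subseteq> {(complex_of_real r + \<i> * complex_of_real y\<^sub>0)\<^sup>2 | r. r \<in> (UNIV :: real set)}
             + complex_of_real ` {0..}) \<and>
      (a + d < 0 \<longrightarrow>
         Spec (matrix_times_op (A4 a d) D_op)
           \<subseteq> {- (complex_of_real r + \<i> * complex_of_real y\<^sub>0)\<^sup>2 | r. r \<in> (UNIV :: real set)}
             + complex_of_real ` {..0}))"
proof -
  let ?S = "Spec (matrix_times_op (A4 a d) D_op)" and ?s = "complex_of_real (sgn (a + d))"
  obtain \<mu> \<delta> \<sigma> :: real where p: "\<mu> \<ge> 1" "\<delta> \<noteq> 0" "\<bar>\<delta>\<bar> < \<sigma>"
    and iff: "\<And>w :: complex. w \<noteq> 0 \<Longrightarrow> ?s * w\<^sup>2 \<in> ?S \<longleftrightarrow>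
       2 - (1 + of_real \<mu>) * cos (of_real \<delta> * w) + (of_real \<mu> - 1) * cos (of_real \<sigma> * w) = 0"
    using Spec_A4_iff[OF assms] by blast
  have s: "?s * ?s = 1" "norm ?s = 1" using assms(3) by (auto simp: sgn_if)
  have "infinite ?S"
  proof
    assume "finite ?S"
    then obtain B where B: "\<And>z. z \<in> ?S \<Longrightarrow> norm z \<le> B"
      using finite_imp_bounded bounded_iff by metis
    \<comment> \<open>A zero beyond 1 and beyond \<open>B\<close> gives a point of the spectrum of
      norm x^2 > x > B.\<close>
    obtain x where x: "x > max 1 B" "2 - (1 + \<mu>) * cos (\<delta> * x) + (\<mu> - 1) * cos (\<sigma> * x) = 0"
      using two_cosine_real_zeros_unbounded[OF p(1,2)] by blast
    have "2 - (1 + of_real \<mu>) * cos (of_real \<delta> * of_real x) + (of_real \<mu> - 1) * cos (of_real \<sigma> * of_real x)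
        = complex_of_real (2 - (1 + \<mu>) * cos (\<delta> * x) + (\<mu> - 1) * cos (\<sigma> * x))"
      by (simp add: cos_of_real[symmetric])
    then have "?s * (of_real x)\<^sup>2 \<in> ?S" using x by (subst iff) auto
    then have "x\<^sup>2 \<le> B" using B s(2) by (fastforce simp: norm_mult norm_power)
    moreover have "x * 1 \<le> x * x" using x by (intro mult_left_mono) auto
    ultimately show False using x by (simp add: power2_eq_square)
  qed
  moreover obtain Y where Y: "Y > 0"
    "\<And>w. 2 - (1 + of_real \<mu>) * cos (of_real \<delta> * w) + (of_real \<mu> - 1) * cos (of_real \<sigma> * w) = (0::complex) \<Longrightarrow> \<bar>Im w\<bar> \<le> Y"
    using two_cosine_zeros_in_strip[OF p] by blast
  have region: "\<exists>r t. t \<ge> 0 \<and> z = ?s * ((of_real r + \<i> * of_real Y)\<^sup>2 + of_real t)" if z: "z \<in> ?S" for z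
  proof -
    define w where "w = csqrt (?s * z)"
    have w: "?s * w\<^sup>2 = z" using s(1) by (simp add: w_def mult.assoc[symmetric])
    have "\<bar>Im w\<bar> \<le> Y"
      using iff[of w] Y w z by (cases "w = 0") auto
    then obtain r t where "t \<ge> 0" "w\<^sup>2 = (of_real r + \<i> * of_real Y)\<^sup>2 + of_real t"
      using power2_in_parabola_region[OF Y(1)] by blast
    then show ?thesis using w by metis
  qed
  have "?S \<subseteq> {(complex_of_real r + \<i> * complex_of_real Y)\<^sup>2 | r. r \<in> (UNIV :: real set)}
             + complex_of_real ` {0..}" if "a + d > 0"
  proof
    fix z assume "z \<in> ?S"
    moreover have "?s = 1" using that by simp
    ultimately obtain r t where "t \<ge> 0" "z = (of_real r + \<i> * of_real Y)\<^sup>2 + of_real t"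
      using region[of z] by (metis mult_1)
    then show "z \<in> {(complex_of_real r + \<i> * complex_of_real Y)\<^sup>2 | r. r \<in> (UNIV :: real set)}
             + complex_of_real ` {0..}"
      by (auto intro!: set_plus_intro)
  qed
  moreover have "?S \<subseteq> {- (complex_of_real r + \<i> * complex_of_real Y)\<^sup>2 | r. r \<in> (UNIV :: real set)}
             + complex_of_real ` {..0}" if "a + d < 0"
  proof
    fix z assume "z \<in> ?S"
    then obtain r t where "t \<ge> 0" "z = ?s * ((of_real r + \<i> * of_real Y)\<^sup>2 + of_real t)"
      using region[of z] by blast
    moreover have "?s = -1" using that by simp
    ultimately have "t \<ge> 0" "z = - (of_real r + \<i> * of_real Y)\<^sup>2 + of_real (- t)" by simp_all
    then show "z \<in> {- (complex_of_real r + \<i> * complex_of_real Y)\<^sup>2 | r. r \<in> (UNIV :: real set)}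
             + complex_of_real ` {..0}"
      by (metis (mono_tags, lifting) UNIV_I atMost_iff imageI mem_Collect_eq neg_le_0_iff_le set_plus_intro)
  qed
  ultimately show ?thesis using Y(1) by blast
qed

end
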